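(* Let $f$ be a neutral scoring rule (defined for profiles over every finite candidate set) that is consistent with linearity, resistant to cloning, and satisfies inclusion clearance. Then there are functions $h^*,h:\mathbb Z_{\ge1}\to\mathbb R_{>0}$ such that $f$ is induced, on every finite candidate set $C$, by the cost function with $\mathrm{cost}(A,\triangleleft)=0$ if $A$ is an interval of $\triangleleft$, and otherwise $\mathrm{cost}(A,\triangleleft)=h^*(n)$ if $A$ contains both the leftmost and the rightmost candidate of $\triangleleft$ and $\mathrm{cost}(A,\triangleleft)=h(n)$ if not, where $n\ge1$ is the number of contiguous holes that $A$ creates in $\triangleleft$. Moreover $h^*(n)\le h(n)\le h^*(n+1)$ for all $n\ge1$.
   Context: Candidates come from a fixed infinite universe; rules are defined for profiles over every finite candidate set $C$. An approval ballot is a nonempty subset $A\subseteq C$; a profile over $C$ is a finite sequence of ballots. An axis is a strict linear order $\triangleleft$ on $C$; $\overleftarrow{\triangleleft}$ its reverse. A ballot $A$ is an interval of $\triangleleft$ if for all $a,b\in A$ and every $c$ with $a\triangleleft c\triangleleft b$ we have $c\in A$. The contiguous holes of $A$ in $\triangleleft$ are the maximal sets of consecutive (on $\triangleleft$) candidates not in $A$ that lie strictly between two candidates of $A$. A profile is linear if some axis makes all its ballots intervals; $\mathrm{con}(P)$ is the set of such axes. An axis rule maps each profile $P$ over $C$ to a nonempty set $f(P)$ of axes on $C$ closed under reversal. $f$ is a scoring rule if for every finite $C$ there is a cost function $\mathrm{cost}_C$ on (nonempty ballot, axis) pairs with values in $\mathbb R_{\ge0}$ and $f(P)=\arg\min_{\triangleleft}\sum_{A\in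 P}\mathrm{cost}_C(A,\triangleleft)$; it is then induced by these cost functions. $f$ is neutral if $f(\pi(P))=\pi(f(P))$ for every bijection $\pi:C\to C'$. $f$ is consistent with linearity if $f(P)=\mathrm{con}(P)$ for every linear profile. Two candidates $a,a'$ are clones in $P$ if for every $A\in P$, $a\in A$ iff $a'\in A$. $P_{-c}$ is the profile over $C\setminus\{c\}$ obtained by removing $c$ from every ballot (ballots becoming empty are discarded); $\triangleleft_{-c}$ is the restriction of $\triangleleft$. $f$ is resistant to cloning if for every profile $P$ with clones $a,a'$: (1) for every $\triangleleft\in f(P)$, $\triangleleft_{-a}\in f(P_{-a})$; and (2) for every $\triangleleft^*\in f(P_{-a})$ there is $\triangleleft\in f(P)$ with $\triangleleft_{-a}=\triangleleft^*$. $f$ satisfies inclusion clearance if for every profile $P$, letting $X$ be the set of candidates approved by no ballot of $P$, there is $\triangleleft\in f(P)$ such that no $A\in P$ has $y,z\in A$, $x\in X$ with $y\triangleleft x\triangleleft z$, and moreover every axis $\triangleleft'$ that has the same property (candidates of $X$ interfere with no ballot) and coincides with $\triangleleft$ on $C\setminus X$ is also in $f(P)$. *)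

theory Defs
  imports Complex_Main
begin

text \<open>An axis on a finite candidate set C is represented by the list of its
candidates from left to right (a distinct list whose set is C); the strict
linear order is "occurs strictly earlier in the list". Reversal is rev.\<close>

definition is_axis :: "'a set \<Rightarrow> 'a list \<Rightarrow> bool" where
  "is_axis C ax \<longleftrightarrow> distinct ax \<and> set ax = C"

definition axes :: "'a set \<Rightarrow> 'a list set" where
  "axes C = {ax. is_axis C ax}"

definition before :: "'a list \<Rightarrow> 'a \<Rightarrow> 'a \<Rightarrow> bool" where
  "before ax x y \<longleftrightarrow> (\<exists>i j. i < j \<and> j < length ax \<and> ax ! i = x \<and> ax ! j = y)"

definition is_profile :: "'a set \<Rightarrow> 'a set list \<Rightarrow> bool" where
  "is_profile C P \<longleftrightarrow> (\<forall>A \<in> set P. A \<noteq> {} \<and> A \<subseteq> C)"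

definition is_interval :: "'a set \<Rightarrow> 'a list \<Rightarrow> bool" where
  "is_interval A ax \<longleftrightarrow>
     (\<forall>a b c. a \<in> A \<longrightarrow> b \<in> A \<longrightarrow> before ax a c \<longrightarrow> before ax c b \<longrightarrow> c \<in> A)"

definition con :: "'a set \<Rightarrow> 'a set list \<Rightarrow> 'a list set" where
  "con C P = {ax. is_axis C ax \<and> (\<forall>A \<in> set P. is_interval A ax)}"

definition linear_profile :: "'a set \<Rightarrow> 'a set list \<Rightarrow> bool" where
  "linear_profile C P \<longleftrightarrow> con C P \<noteq> {}"

text \<open>Number of contiguous holes of A in ax: each hole is a maximal run of
non-members lying strictly between two members; it is counted by its first
position i (ax!(i-1) is a member, ax!i is not, and some member occurs later).\<close>
definition num_holes :: "'a set \<Rightarrow> 'a list \<Rightarrow> nat" where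
  "num_holes A ax = card {i. 0 < i \<and> i < length ax \<and> ax ! i \<notin> A \<and> ax ! (i - 1) \<in> A
                              \<and> (\<exists>j. i < j \<and> j < length ax \<and> ax ! j \<in> A)}"

type_synonym 'a axis_rule = "'a set \<Rightarrow> 'a set list \<Rightarrow> 'a list set"

definition is_axis_rule :: "'a axis_rule \<Rightarrow> bool" where
  "is_axis_rule f \<longleftrightarrow> (\<forall>C P. finite C \<longrightarrow> is_profile C P \<longrightarrow>
      f C P \<noteq> {} \<and> f C P \<subseteq> axes C \<and> (\<forall>ax \<in> f C P. rev ax \<in> f C P))"

definition total_cost :: "('a set \<Rightarrow> 'a list \<Rightarrow> real) \<Rightarrow> 'a set list \<Rightarrow> 'a list \<Rightarrow> real" where
  "total_cost cost P ax = (\<Sum>A\<leftarrow>P. cost A ax)"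

definition argmin_axes :: "('a set \<Rightarrow> 'a list \<Rightarrow> real) \<Rightarrow> 'a set \<Rightarrow> 'a set list \<Rightarrow> 'a list set" where
  "argmin_axes cost C P =
     {ax. is_axis C ax \<and> (\<forall>ax'. is_axis C ax' \<longrightarrow> total_cost cost P ax \<le> total_cost cost P ax')}"

definition induced_on :: "'a axis_rule \<Rightarrow> 'a set \<Rightarrow> ('a set \<Rightarrow> 'a list \<Rightarrow> real) \<Rightarrow> bool" where
  "induced_on f C cost \<longleftrightarrow> (\<forall>P. is_profile C P \<longrightarrow> f C P = argmin_axes cost C P)"

definition scoring_rule :: "'a axis_rule \<Rightarrow> bool" where
  "scoring_rule f \<longleftrightarrow> (\<forall>C. finite C \<longrightarrow>
     (\<exists>cost. (\<forall>A ax. A \<noteq> {} \<longrightarrow> A \<subseteq> C \<longrightarrow> is_axis C ax \<longrightarrow> cost A ax \<ge> 0)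
            \<and> induced_on f C cost))"

definition neutral :: "'a axis_rule \<Rightarrow> bool" where
  "neutral f \<longleftrightarrow> (\<forall>C C' \<pi> P. finite C \<longrightarrow> bij_betw \<pi> C C' \<longrightarrow> is_profile C P \<longrightarrow>
      f C' (map (\<lambda>A. \<pi> ` A) P) = (map \<pi>) ` f C P)"

definition consistent_with_linearity :: "'a axis_rule \<Rightarrow> bool" where
  "consistent_with_linearity f \<longleftrightarrow> (\<forall>C P. finite C \<longrightarrow> is_profile C P \<longrightarrow>
      linear_profile C P \<longrightarrow> f C P = con C P)"

definition clones :: "'a set list \<Rightarrow> 'a \<Rightarrow> 'a \<Rightarrow> bool" where
  "clones P a a' \<longleftrightarrow> (\<forall>A \<in> set P. a \<in> A \<longleftrightarrow> a' \<in> A)"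

definition remove_cand :: "'a \<Rightarrow> 'a set list \<Rightarrow> 'a set list" where
  "remove_cand c P = filter (\<lambda>A. A \<noteq> {}) (map (\<lambda>A. A - {c}) P)"

definition restrict_axis :: "'a \<Rightarrow> 'a list \<Rightarrow> 'a list" where
  "restrict_axis c ax = filter (\<lambda>x. x \<noteq> c) ax"

definition resistant_to_cloning :: "'a axis_rule \<Rightarrow> bool" where
  "resistant_to_cloning f \<longleftrightarrow> (\<forall>C P a a'. finite C \<longrightarrow> is_profile C P \<longrightarrow>
      a \<in> C \<longrightarrow> a' \<in> C \<longrightarrow> a \<noteq> a' \<longrightarrow> clones P a a' \<longrightarrow>
      (\<forall>ax \<in> f C P. restrict_axis a ax \<in> f (C - {a}) (remove_cand a P)) \<and>
      (\<forall>ax' \<in> f (C - {a}) (remove_cand a P). \<exists>ax \<in> f C P. restrict_axis a ax = ax'))"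

definition clears :: "'a set list \<Rightarrow> 'a set \<Rightarrow> 'a list \<Rightarrow> bool" where
  "clears P X ax \<longleftrightarrow> \<not> (\<exists>A \<in> set P. \<exists>y z x. y \<in> A \<and> z \<in> A \<and> x \<in> X \<and> before ax y x \<and> before ax x z)"

definition inclusion_clearance :: "'a axis_rule \<Rightarrow> bool" where
  "inclusion_clearance f \<longleftrightarrow> (\<forall>C P. finite C \<longrightarrow> is_profile C P \<longrightarrow>
      (let X = C - \<Union>(set P) in
        \<exists>ax \<in> f C P. clears P X ax \<and>
          (\<forall>ax'. is_axis C ax' \<longrightarrow> clears P X ax' \<longrightarrow>
                 filter (\<lambda>x. x \<notin> X) ax' = filter (\<lambda>x. x \<notin> X) ax \<longrightarrow> ax' \<in> f C P)))"

definition hole_cost :: "(nat \<Rightarrow> real) \<Rightarrow> (nat \<Rightarrow> real) \<Rightarrow> 'a set \<Rightarrow> 'a list \<Rightarrow> real" where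
  "hole_cost hs h A ax =
     (if is_interval A ax then 0
      else if hd ax \<in> A \<and> last ax \<in> A then hs (num_holes A ax)
      else h (num_holes A ax))"

end

theory Submission
  imports Defs
begin

text \<open>Subtracting minima, the cost of a ballot on an axis can be assumed to vanish exactly
when the ballot is an interval. Repeating a linear profile often enough restricts the choice to its
consistent axes, so one can compare the costs of any two axes that differ by swapping two
neighbours, and it follows that the normalised cost on at least three candidates is unique up to a
positive factor. By neutrality it then depends only on the 0/1-word of the ballot along the axis.
Forcing two clones to be adjacent shows that duplicating a letter multiplies all costs by a
constant, which is 1 once the cost of the words 10...01 is normalised; so the cost depends only on
the word with repeated letters contracted. Such a word is determined by its number of holes and by
which ends it contains; moving a never approved candidate from one end of the axis to the other
(inclusion clearance) identifies the three cases in which an end is missing. The two inequalities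
come from one further application of cloning and of clearance, respectively.\<close>

section \<open>Axes and intervals\<close>

lemma before_Nil [simp]: "\<not> before [] x y"
  by (simp add: before_def)

lemma before_Cons [simp]: "before (a # ax) x y \<longleftrightarrow> x = a \<and> y \<in> set ax \<or> before ax x y"
proof
  assume "before (a # ax) x y"
  then obtain i j where "i < j" "j < length (a # ax)" "(a # ax) ! i = x" "(a # ax) ! j = y"
    by (auto simp: before_def)
  then show "x = a \<and> y \<in> set ax \<or> before ax x y"
    by (cases i; cases j) (auto simp: before_def)
next
  assume "x = a \<and> y \<in> set ax \<or> before ax x y"
  then show "before (a # ax) x y"
  proof
    assume "x = a \<and> y \<in> set ax"
    then obtain k where "k < length ax" "ax ! k = y" "x = a" by (auto simp: in_set_conv_nth)
    then show ?thesis unfolding before_def by (intro exI[of _ 0] exI[of _ "Suc k"]) auto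
  next
    assume "before ax x y"
    then show ?thesis unfolding before_def by (metis Suc_less_eq length_Cons nth_Cons_Suc)
  qed
qed

lemma before_append [simp]:
  "before (xs @ ys) x y \<longleftrightarrow> before xs x y \<or> before ys x y \<or> x \<in> set xs \<and> y \<in> set ys"
  by (induction xs) auto

lemma before_rev [simp]: "before (rev ax) x y \<longleftrightarrow> before ax y x"
  by (induction ax) auto

lemma before_filter [simp]: "before (filter p ax) x y \<longleftrightarrow> before ax x y \<and> p x \<and> p y"
  by (induction ax) auto

lemma in_set_if_before: "before ax x y \<Longrightarrow> x \<in> set ax \<and> y \<in> set ax"
  by (induction ax) auto

lemma is_interval_rev [simp]: "is_interval A (rev ax) \<longleftrightarrow> is_interval A ax"
  by (auto simp: is_interval_def)

lemma is_interval_restrict_axis: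
  "is_interval A ax \<Longrightarrow> is_interval (A - {x}) (restrict_axis x ax)"
  unfolding is_interval_def restrict_axis_def by auto

lemma is_interval_infix:
  assumes "distinct (u @ v @ w)"
  shows "is_interval (set v) (u @ v @ w)"
  using assms by (auto simp: is_interval_def dest: in_set_if_before)

lemma is_interval_adjacent_pair: "distinct (u @ x # y # v) \<Longrightarrow> is_interval {x, y} (u @ x # y # v)"
  using is_interval_infix[of u "[x, y]" v] by simp

lemma is_interval_singleton: "distinct ax \<Longrightarrow> is_interval {x} ax"
  by (induction ax) (auto simp: is_interval_def dest: in_set_if_before)

lemma not_is_interval_separated_pair:
  assumes "distinct (u @ x # y # z # v)"
  shows "\<not> is_interval {x, z} (u @ x # y # z # v)"
proof -
  have "before (u @ x # y # z # v) x y" "before (u @ x # y # z # v) y z" "y \<notin> {x, z}"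
    using assms by auto
  then show ?thesis unfolding is_interval_def by blast
qed

lemma adjacent_if_is_interval_pair:
  assumes "distinct ax" "a \<in> set ax" "b \<in> set ax" "a \<noteq> b" "is_interval {a, b} ax"
  obtains u v where "ax = u @ a # b # v" | u v where "ax = u @ b # a # v"
proof -
  have gap_empty: "s = []" if "ax = u @ p # s @ q # v" "{p, q} = {a, b}" for u p s q v
  proof (cases s)
    case (Cons c t)
    then have "before ax p c" "before ax c q" "c \<notin> {p, q}" using assms(1) that(1) by auto
    then show ?thesis using assms(5) that(2) unfolding is_interval_def by blast
  qed
  obtain u w where ax: "ax = u @ a # w" using assms(2) by (meson split_list)
  with assms have "b \<in> set u \<or> b \<in> set w" by auto
  then show ?thesis
  proof
    assume "b \<in> set w"
    then obtain s v where "w = s @ b # v" by (meson split_list)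
    then show ?thesis using gap_empty[of u a s b v] ax that(1) by auto
  next
    assume "b \<in> set u"
    then obtain s v where "u = v @ b # s" by (meson split_list)
    then show ?thesis using gap_empty[of v b s a w] ax that(2) by (auto simp: insert_commute)
  qed
qed

lemma subset_if_is_interval_ends:
  assumes "is_interval A ax" "hd ax \<in> A" "last ax \<in> A"
  shows "set ax \<subseteq> A"
proof
  fix c assume "c \<in> set ax"
  then obtain u v where ax: "ax = u @ c # v" by (meson split_list)
  show "c \<in> A"
  proof (cases "u = [] \<or> v = []")
    case False
    then have "before ax (hd ax) c" "before ax c (last ax)" using ax by auto
    then show ?thesis using assms unfolding is_interval_def by blast
  qed (use assms ax in auto)
qed

lemma is_interval_initial:
  assumes "distinct ax" "is_interval A ax" "A \<subseteq> set ax" "hd ax \<in> A" "ax \<noteq> []"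
  shows "set (take (card A) ax) = A"
proof -
  let ?t = "takeWhile (\<lambda>x. x \<in> A) ax" and ?d = "dropWhile (\<lambda>x. x \<in> A) ax"
  have "A \<inter> set ?d = {}"
  proof (cases ?d)
    case (Cons c v)
    then have "c \<notin> A" by (metis dropWhile_eq_Cons_conv)
    have ax: "ax = ?t @ c # v" using Cons by (metis takeWhile_dropWhile_id)
    have "hd ax \<in> set ?t" using assms(4,5) by (cases ax) auto
    then have "before ax (hd ax) c" by (subst ax) simp
    moreover have "before ax c y" if "y \<in> set v" for y by (subst ax) (simp add: that)
    ultimately have "y \<notin> A" if "y \<in> set v" for y
      using that assms(2,4) \<open>c \<notin> A\<close> unfolding is_interval_def by blast
    then show ?thesis using Cons \<open>c \<notin> A\<close> by auto
  qed (simp only: list.set Int_empty_right)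
  moreover have "set ax = set ?t \<union> set ?d" by (metis set_append takeWhile_dropWhile_id)
  ultimately have "set ?t = A" using assms(3) by (auto dest: set_takeWhileD)
  moreover from this have "length ?t = card A"
    using assms(1) by (metis distinct_card distinct_takeWhile)
  ultimately show ?thesis by (metis takeWhile_eq_take)
qed

lemma is_axis_rev [simp]: "is_axis C (rev ax) \<longleftrightarrow> is_axis C ax"
  by (simp add: is_axis_def)

lemma length_axis: "is_axis C ax \<Longrightarrow> length ax = card C"
  by (auto simp: is_axis_def distinct_card)

lemma mem_axes [simp]: "ax \<in> axes C \<longleftrightarrow> is_axis C ax"
  by (simp add: axes_def)

lemma finite_axes: "finite C \<Longrightarrow> finite (axes C)"
  by (rule finite_subset[OF _ finite_lists_length_eq[of C "card C"]])
    (auto simp: is_axis_def distinct_card)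

lemma ex_axis: "finite C \<Longrightarrow> \<exists>ax. is_axis C ax"
  using finite_distinct_list by (auto simp: is_axis_def)

lemma ex_axis_is_interval:
  assumes "finite C" "A \<subseteq> C"
  shows "\<exists>ax. is_axis C ax \<and> is_interval A ax"
proof -
  obtain xs ys where "is_axis A xs" "is_axis (C - A) ys"
    using assms ex_axis by (meson finite_Diff finite_subset)
  then have "is_axis C (xs @ ys)" "is_interval A (xs @ ys)"
    using is_interval_infix[of "[]" xs ys] assms(2) by (auto simp: is_axis_def)
  then show ?thesis by blast
qed

lemma is_axis_restrict_axis: "is_axis C ax \<Longrightarrow> is_axis (C - {x}) (restrict_axis x ax)"
  by (auto simp: is_axis_def restrict_axis_def)

lemma restrict_axis_notin [simp]: "x \<notin> set ax \<Longrightarrow> restrict_axis x ax = ax"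
  by (auto simp: restrict_axis_def intro: filter_True)

lemma restrict_axis_append [simp]: "restrict_axis x (u @ v) = restrict_axis x u @ restrict_axis x v"
  by (simp add: restrict_axis_def)

lemma restrict_axis_Cons [simp]:
  "restrict_axis x (y # v) = (if x = y then restrict_axis x v else y # restrict_axis x v)"
  by (simp add: restrict_axis_def)

section \<open>Words and holes\<close>

definition word :: "'a set \<Rightarrow> 'a list \<Rightarrow> bool list" where
  "word A ax = map (\<lambda>x. x \<in> A) ax"

fun holes :: "bool list \<Rightarrow> nat" where
  "holes (x # y # w) = of_bool (x \<and> \<not> y \<and> True \<in> set w) + holes (y # w)"
| "holes _ = 0"

lemma length_word [simp]: "length (word A ax) = length ax"
  by (simp add: word_def)

lemma word_simps [simp]:
  "word A [] = []"
  "word A (x # xs) = (x \<in> A) # word A xs"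
  "word A (xs @ ys) = word A xs @ word A ys"
  by (simp_all add: word_def)

lemma word_eq_Cons_iff:
  "word A ax = b # w \<longleftrightarrow> (\<exists>x xs. ax = x # xs \<and> (x \<in> A \<longleftrightarrow> b) \<and> word A xs = w)"
  by (auto simp: word_def)

lemma word_rev: "word A (rev xs) = rev (word A xs)"
  by (simp add: word_def rev_map)

lemma word_insert_notin [simp]: "x \<notin> set xs \<Longrightarrow> word (insert x A) xs = word A xs"
  by (auto simp: word_def)

lemma True_in_set_word: "True \<in> set (word A ax) \<longleftrightarrow> A \<inter> set ax \<noteq> {}"
  by (auto simp: word_def)

lemma ex_ballot_word:
  assumes "distinct ax" "length w = length ax"
  obtains A where "A \<subseteq> set ax" "word A ax = w"
proof
  let ?A = "{ax ! i | i. i < length ax \<and> w ! i}"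
  show "?A \<subseteq> set ax" by auto
  show "word ?A ax = w"
    using assms by (auto simp: word_def nth_eq_iff_index_eq intro!: nth_equalityI)
qed

lemma num_holes_eq_sum:
  "num_holes A ax = (\<Sum>i<length ax - 1.
     of_bool (ax ! i \<in> A \<and> ax ! Suc i \<notin> A \<and> True \<in> set (word A (drop (Suc (Suc i)) ax))))"
proof -
  let ?hole = "\<lambda>i. ax ! i \<in> A \<and> ax ! Suc i \<notin> A \<and> True \<in> set (word A (drop (Suc (Suc i)) ax))"
  have later: "(\<exists>j. i < j \<and> j < length ax \<and> ax ! j \<in> A) \<longleftrightarrow> True \<in> set (word A (drop (Suc i) ax))"
    for i
  proof
    assume "\<exists>j. i < j \<and> j < length ax \<and> ax ! j \<in> A"
    then obtain j where "i < j" "j < length ax" "ax ! j \<in> A" by blast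
    moreover from this have "drop (Suc i) ax ! (j - Suc i) \<in> set (drop (Suc i) ax)"
      by (intro nth_mem) simp
    ultimately show "True \<in> set (word A (drop (Suc i) ax))" by (auto simp: True_in_set_word)
  next
    assume "True \<in> set (word A (drop (Suc i) ax))"
    then obtain k where "k < length ax - Suc i" "ax ! (Suc i + k) \<in> A"
      by (auto simp: word_def in_set_conv_nth)
    then show "\<exists>j. i < j \<and> j < length ax \<and> ax ! j \<in> A"
      by (intro exI[of _ "Suc i + k"]) auto
  qed
  have "{i. 0 < i \<and> i < length ax \<and> ax ! i \<notin> A \<and> ax ! (i - 1) \<in> A \<and>
      (\<exists>j. i < j \<and> j < length ax \<and> ax ! j \<in> A)} = Suc ` ({..<length ax - 1} \<inter> {i. ?hole i})"
    unfolding later by (auto simp: image_iff gr0_conv_Suc)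
  then show ?thesis by (simp add: num_holes_def card_image)
qed

lemma num_holes_word: "num_holes A ax = holes (word A ax)"
proof (induction ax rule: induct_list012)
  case (3 x y zs)
  then show ?case by (simp add: num_holes_eq_sum sum.lessThan_Suc_shift del: sum.lessThan_Suc)
qed (simp_all add: num_holes_def)

lemma is_interval_Cons:
  assumes "x \<notin> set ax"
  shows "is_interval A (x # ax) \<longleftrightarrow>
    is_interval A ax \<and> (x \<in> A \<longrightarrow> (\<forall>c b. before ax c b \<longrightarrow> b \<in> A \<longrightarrow> c \<in> A))"
    (is "?l \<longleftrightarrow> ?r")
proof
  assume ?l
  then show ?r unfolding is_interval_def before_Cons by (blast dest: in_set_if_before)
next
  assume ?r
  moreover have "c \<noteq> x" if "before (x # ax) a c" for a c
    using that assms by (auto dest: in_set_if_before)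
  ultimately show ?l unfolding is_interval_def before_Cons by blast
qed

lemma is_interval_iff_holes:
  assumes "distinct ax"
  shows "is_interval A ax \<longleftrightarrow> holes (word A ax) = 0"
  using assms
proof (induction ax rule: induct_list012)
  case (3 x y zs)
  have "is_interval A (x # y # zs) \<longleftrightarrow>
      is_interval A (y # zs) \<and> (x \<in> A \<longrightarrow> (\<forall>c b. before (y # zs) c b \<longrightarrow> b \<in> A \<longrightarrow> c \<in> A))"
    using 3(3) by (intro is_interval_Cons) simp
  also have "\<dots> \<longleftrightarrow> is_interval A (y # zs) \<and> \<not> (x \<in> A \<and> y \<notin> A \<and> A \<inter> set zs \<noteq> {})"
    using 3(3) by (auto simp: is_interval_Cons dest: in_set_if_before)
  also have "\<dots> \<longleftrightarrow> holes (word A (x # y # zs)) = 0"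
    using 3 by (auto simp: True_in_set_word)
  finally show ?case .
qed (simp_all add: is_interval_def)

lemma holes_Cons_False [simp]: "holes (False # w) = holes w"
  by (cases w) auto

lemma holes_snoc_False [simp]: "holes (w @ [False]) = holes w"
  by (induction w rule: holes.induct) auto

lemma holes_duplicate: "holes (u @ b # b # v) = holes (u @ b # v)"
proof (induction u)
  case (Cons x u)
  then show ?case by (cases u) auto
qed (cases b; simp)

lemma holes_remdups_adj: "holes (u @ remdups_adj w) = holes (u @ w)"
proof (induction w arbitrary: u rule: remdups_adj.induct)
  case (3 x y xs)
  show ?case
  proof (cases "x = y")
    case True
    then show ?thesis using 3(1)[OF True, of u] holes_duplicate[of u y xs] by simp
  next
    case False
    then show ?thesis using 3(2)[OF False, of "u @ [x]"] by simp
  qed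
qed auto

section \<open>Rigid blocks\<close>

definition cuts :: "'a list \<Rightarrow> nat list \<Rightarrow> 'a set list" where
  "cuts Y I = map (\<lambda>i. set (take i Y)) I @ map (\<lambda>i. set (drop i Y)) I"

definition agrees_at :: "'a list \<Rightarrow> nat list \<Rightarrow> 'a list \<Rightarrow> bool" where
  "agrees_at Y I ax \<longleftrightarrow> (\<forall>i \<in> set I. set (take i ax) = set (take i Y))"

definition outside_block :: "'a list \<Rightarrow> 'a list \<Rightarrow> 'a list \<Rightarrow> nat list" where
  "outside_block U M V =
     [i \<leftarrow> [1..<length (U @ M @ V)]. i \<le> length U \<or> length (U @ M) \<le> i]"

definition block_cuts :: "'a list \<Rightarrow> 'a list \<Rightarrow> 'a list \<Rightarrow> 'a set list" where
  "block_cuts U M V = cuts (U @ M @ V) (outside_block U M V)"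

definition block_axes :: "'a list \<Rightarrow> 'a list \<Rightarrow> 'a list \<Rightarrow> 'a list set" where
  "block_axes U M V = {U @ N @ V | N. distinct N \<and> set N = set M}"

lemma set_drop_axis: "is_axis C ax \<Longrightarrow> set (drop i ax) = C - set (take i ax)"
proof -
  assume "is_axis C ax"
  then have "set (take i ax) \<union> set (drop i ax) = C" "set (take i ax) \<inter> set (drop i ax) = {}"
    using set_take_disj_set_drop_if_distinct[of ax i i]
    by (simp_all add: is_axis_def flip: set_append)
  then show ?thesis by blast
qed

lemma con_rev [simp]: "rev ax \<in> con C L \<longleftrightarrow> ax \<in> con C L"
  by (simp add: con_def)

lemma mem_con_cutsI:
  assumes "is_axis C ax" "is_axis C Y" "agrees_at Y I ax"
  shows "ax \<in> con C (cuts Y I)"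
proof -
  have "is_interval (set (take i ax)) ax" "is_interval (set (drop i ax)) ax" for i
    using assms(1) is_interval_infix[of "[]" "take i ax" "drop i ax"]
      is_interval_infix[of "take i ax" "drop i ax" "[]"] by (simp_all add: is_axis_def)
  moreover have "set (take i Y) = set (take i ax)" "set (drop i Y) = set (drop i ax)"
    if "i \<in> set I" for i
    using that assms by (simp_all add: agrees_at_def set_drop_axis)
  ultimately show ?thesis using assms(1) by (auto simp: con_def cuts_def)
qed

lemma hd_mem_iff_last_notin_if_is_interval:
  assumes "is_interval A ax" "is_interval (set ax - A) ax" "A \<noteq> {}" "A \<subset> set ax"
  shows "hd ax \<in> A \<longleftrightarrow> last ax \<notin> A"
proof -
  have "\<not> set ax \<subseteq> A" "\<not> set ax \<subseteq> set ax - A" using assms(3,4) by auto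
  moreover have "ax \<noteq> []" using assms(4) by auto
  then have "hd ax \<in> set ax" "last ax \<in> set ax" by simp_all
  ultimately show ?thesis
    using subset_if_is_interval_ends[OF assms(1)] subset_if_is_interval_ends[OF assms(2)] by blast
qed

text \<open>An end of the axis lies in the prefix or in the suffix of a cut, never both ends in the same
  one; so the ends are separated in the same way by all cuts, and prefixes are initial segments.\<close>

lemma con_cuts_agrees:
  assumes Y: "is_axis C Y" and I: "\<forall>i \<in> set I. 0 < i \<and> i < length Y" and ax: "ax \<in> con C (cuts Y I)"
  shows "agrees_at Y I ax \<or> agrees_at Y I (rev ax)"
proof -
  have axis: "is_axis C ax"
    and int: "\<And>i. i \<in> set I \<Longrightarrow> is_interval (set (take i Y)) ax \<and> is_interval (set (drop i Y)) ax"
    using ax by (auto simp: con_def cuts_def)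
  have agrees: "set (take i bx) = set (take i Y)"
    if "i \<in> set I" "hd bx \<in> set (take i Y)" "bx \<in> {ax, rev ax}" for i bx
  proof -
    have "card (set (take i Y)) = i" using Y I that(1) by (simp add: is_axis_def distinct_card)
    moreover have "set (take i Y) \<subseteq> set bx" "distinct bx" "bx \<noteq> []"
      using Y I axis that by (auto simp: is_axis_def dest: in_set_takeD)
    ultimately show ?thesis
      using is_interval_initial[of bx "set (take i Y)"] int that by auto
  qed
  have ends: "hd ax \<in> set (take i Y) \<longleftrightarrow> last ax \<notin> set (take i Y)" if i: "i \<in> set I" for i
  proof -
    have drop: "set (drop i Y) = set ax - set (take i Y)"
      using set_drop_axis[OF Y] axis by (simp add: is_axis_def)
    have "take i Y \<noteq> []" "drop i Y \<noteq> []" using I i by auto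
    then obtain p q where "p \<in> set (take i Y)" "q \<in> set (drop i Y)" by (meson hd_in_set)
    moreover have "set (take i Y) \<subseteq> set ax"
      using set_take_subset[of i Y] Y axis by (simp add: is_axis_def)
    ultimately have "set (take i Y) \<noteq> {}" "set (take i Y) \<subset> set ax"
      by (auto simp: drop simp del: set_empty)
    then show ?thesis using int[OF i] hd_mem_iff_last_notin_if_is_interval[of "set (take i Y)" ax]
      by (simp add: drop)
  qed
  have "hd ax \<in> set (take i Y) \<longleftrightarrow> hd ax \<in> set (take j Y)" if "i \<in> set I" "j \<in> set I" "i \<le> j" for i j
    using ends[OF that(1)] ends[OF that(2)] set_take_subset_set_take[OF that(3), of Y] by blast
  then consider "\<forall>i \<in> set I. hd ax \<in> set (take i Y)" | "\<forall>i \<in> set I. hd ax \<notin> set (take i Y)"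
    by (metis linear)
  then show ?thesis
    by cases (use agrees[of _ ax] agrees[of _ "rev ax"] ends in \<open>auto simp: agrees_at_def hd_rev\<close>)
qed

lemma take_eq_if_set_take_eq:
  assumes "distinct ax" "distinct Y" "length ax = length Y"
    and "\<And>i. i \<le> k \<Longrightarrow> set (take i ax) = set (take i Y)"
  shows "take k ax = take k Y"
  using assms(4)
proof (induction k)
  case (Suc k)
  show ?case
  proof (cases "k < length Y")
    case True
    have "set (take (Suc k) Z) - set (take k Z) = {Z ! k}"
      if "distinct Z" "k < length Z" for Z :: "'a list"
      using distinct_take[OF that(1), of "Suc k"] that(2) by (auto simp: take_Suc_conv_app_nth)
    from this[of ax] this[of Y] have "ax ! k = Y ! k"
      using Suc.prems[of k] Suc.prems[of "Suc k"] assms(1-3) True by simp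
    then show ?thesis using Suc assms(3) True by (simp add: take_Suc_conv_app_nth)
  next
    case False
    then show ?thesis using Suc assms(3) by simp
  qed
qed simp

lemma mem_block_axes_if_set_take_eq:
  assumes Y: "is_axis C (U @ M @ V)" and ax: "is_axis C ax"
    and agree: "\<And>i. i \<le> length U \<or> length (U @ M) \<le> i \<Longrightarrow> set (take i ax) = set (take i (U @ M @ V))"
  shows "ax \<in> block_axes U M V"
proof -
  let ?Y = "U @ M @ V"
  have len: "length ax = length ?Y" using Y ax by (simp only: length_axis)
  have dist: "distinct ax" "distinct ?Y" using Y ax by (auto simp: is_axis_def)
  have take: "take (length U) ax = U"
    using take_eq_if_set_take_eq[OF dist len, of "length U"] agree by simp
  have rev_agree: "set (take i (rev ax)) = set (take i (rev ?Y))" if "i \<le> length V" for i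
  proof -
    have "set (take i (rev ax)) = C - set (take (length ax - i) ax)"
      "set (take i (rev ?Y)) = C - set (take (length ax - i) ?Y)"
      using set_drop_axis[OF ax] set_drop_axis[OF Y] len by (simp_all only: take_rev set_rev)
    moreover have "length (U @ M) \<le> length ax - i" using len that by simp
    ultimately show ?thesis using agree[of "length ax - i"] by simp
  qed
  have "take (length V) (rev ax) = take (length V) (rev ?Y)"
    by (rule take_eq_if_set_take_eq)
      (use rev_agree dist len in \<open>simp_all only: distinct_rev length_rev\<close>)
  then have drop: "drop (length (U @ M)) ax = V" using len by (simp add: take_rev)
  define N where "N = drop (length U) (take (length (U @ M)) ax)"
  have "take (length (U @ M)) ax = U @ N"
    using append_take_drop_id[of "length U" "take (length (U @ M)) ax"] take by (simp add: N_def)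
  then have "ax = U @ N @ V"
    using append_take_drop_id[of "length (U @ M)" ax] drop by simp
  moreover from this have "set N = set M" "distinct N"
    using Y ax by (auto simp: is_axis_def)
  ultimately show ?thesis by (auto simp: block_axes_def)
qed

lemma mem_block_axes_iff:
  assumes Y: "is_axis C (U @ M @ V)"
  shows "ax \<in> block_axes U M V \<longleftrightarrow>
    is_axis C ax \<and> agrees_at (U @ M @ V) (outside_block U M V) ax"
proof
  assume "ax \<in> block_axes U M V"
  then obtain N where N: "ax = U @ N @ V" "distinct N" "set N = set M"
    by (auto simp: block_axes_def)
  moreover from this have "length N = length M"
    using Y by (metis distinct_append distinct_card is_axis_def)
  ultimately have "set (take i ax) = set (take i (U @ M @ V))"
    if "i \<le> length U \<or> length (U @ M) \<le> i" for i
    using that by auto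
  then show "is_axis C ax \<and> agrees_at (U @ M @ V) (outside_block U M V) ax"
    using N Y by (auto simp: is_axis_def agrees_at_def outside_block_def)
next
  assume ax: "is_axis C ax \<and> agrees_at (U @ M @ V) (outside_block U M V) ax"
  have "set (take i ax) = set (take i (U @ M @ V))"
    if outside: "i \<le> length U \<or> length (U @ M) \<le> i" for i
  proof -
    consider "i = 0" | "i \<in> set (outside_block U M V)" | "length (U @ M @ V) \<le> i"
      using outside
      by (cases "i = 0"; cases "i < length (U @ M @ V)") (auto simp: outside_block_def)
    then show ?thesis
      by cases (use ax Y length_axis[of C ax] length_axis[OF Y] in
          \<open>auto simp: agrees_at_def is_axis_def\<close>)
  qed
  then show "ax \<in> block_axes U M V" using mem_block_axes_if_set_take_eq[OF Y] ax by blast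
qed

lemma con_block_cuts:
  assumes "distinct (U @ M @ V)" "C = set (U @ M @ V)"
  shows "con C (block_cuts U M V) = block_axes U M V \<union> rev ` block_axes U M V"
proof -
  let ?Y = "U @ M @ V" and ?I = "outside_block U M V"
  have Y: "is_axis C ?Y" using assms by (simp add: is_axis_def)
  have "ax \<in> con C (cuts ?Y ?I) \<longleftrightarrow>
      is_axis C ax \<and> (agrees_at ?Y ?I ax \<or> agrees_at ?Y ?I (rev ax))" for ax
  proof
    assume "ax \<in> con C (cuts ?Y ?I)"
    then show "is_axis C ax \<and> (agrees_at ?Y ?I ax \<or> agrees_at ?Y ?I (rev ax))"
      using con_cuts_agrees[OF Y, of ?I ax] by (auto simp: outside_block_def con_def)
  next
    assume "is_axis C ax \<and> (agrees_at ?Y ?I ax \<or> agrees_at ?Y ?I (rev ax))"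
    then show "ax \<in> con C (cuts ?Y ?I)"
      using mem_con_cutsI[OF _ Y, of ax ?I] mem_con_cutsI[OF _ Y, of "rev ax" ?I] by auto
  qed
  moreover have "ax \<in> rev ` block_axes U M V \<longleftrightarrow> rev ax \<in> block_axes U M V" for ax
    by (metis image_iff rev_rev_ident)
  ultimately show ?thesis
    unfolding block_cuts_def set_eq_iff by (simp add: mem_block_axes_iff[OF Y]) blast
qed

abbreviation rigid :: "'a list \<Rightarrow> 'a set list" where
  "rigid Y \<equiv> block_cuts [] [] Y"

lemma con_rigid: "is_axis C Y \<Longrightarrow> con C (rigid Y) = {Y, rev Y}"
  using con_block_cuts[of "[]" "[]" Y C] by (auto simp: block_axes_def is_axis_def)

lemma Union_rigid:
  assumes "2 \<le> length Y"
  shows "\<Union> (set (rigid Y)) = set Y"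
proof
  have "set (take 1 Y) \<in> set (rigid Y)" "set (drop 1 Y) \<in> set (rigid Y)"
    using assms by (auto simp: block_cuts_def outside_block_def cuts_def)
  moreover have "set Y = set (take 1 Y) \<union> set (drop 1 Y)" by (metis append_take_drop_id set_append)
  ultimately show "set Y \<subseteq> \<Union> (set (rigid Y))" by blast
  show "\<Union> (set (rigid Y)) \<subseteq> set Y"
    by (auto simp: block_cuts_def outside_block_def cuts_def dest: in_set_takeD in_set_dropD)
qed

lemma block_subset_or_disjoint:
  assumes "distinct (U @ M @ V)" "A \<in> set (block_cuts U M V)"
  shows "set M \<subseteq> A \<or> set M \<inter> A = {}"
proof -
  obtain i where i: "i \<le> length U \<or> length (U @ M) \<le> i"
    "A = set (take i (U @ M @ V)) \<or> A = set (drop i (U @ M @ V))"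
    using assms(2) unfolding block_cuts_def outside_block_def cuts_def
    by (auto simp del: take_append drop_append append_assoc)
  from i(1) have "A \<subseteq> set U \<or> A \<subseteq> set V \<or> set M \<subseteq> A"
  proof
    assume "i \<le> length U"
    then show ?thesis using i(2) set_take_subset[of i U] by auto
  next
    assume "length (U @ M) \<le> i"
    then show ?thesis using i(2) set_drop_subset[of _ V] by auto
  qed
  then show ?thesis using assms(1) by auto
qed

lemma is_profile_block_cuts: "set (U @ M @ V) \<subseteq> C \<Longrightarrow> is_profile C (block_cuts U M V)"
  by (fastforce simp: is_profile_def block_cuts_def outside_block_def cuts_def
      simp del: take_append drop_append dest: in_set_takeD in_set_dropD)

section \<open>Normalised costs\<close>

lemma total_cost_simps [simp]:
  "total_cost c [] ax = 0"
  "total_cost c (A # P) ax = c A ax + total_cost c P ax"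
  "total_cost c (P @ Q) ax = total_cost c P ax + total_cost c Q ax"
  "total_cost c (concat (replicate k P)) ax = real k * total_cost c P ax"
proof -
  show "total_cost c (concat (replicate k P)) ax = real k * total_cost c P ax"
    by (induction k) (auto simp: total_cost_def algebra_simps)
qed (simp_all add: total_cost_def)

lemma is_profile_simps [simp]:
  "is_profile C []"
  "is_profile C (A # P) \<longleftrightarrow> A \<noteq> {} \<and> A \<subseteq> C \<and> is_profile C P"
  "is_profile C (P @ Q) \<longleftrightarrow> is_profile C P \<and> is_profile C Q"
  by (auto simp: is_profile_def)

lemma is_profile_cong: "set P = set Q \<Longrightarrow> is_profile C P \<longleftrightarrow> is_profile C Q"
  by (simp add: is_profile_def)

lemma con_cong: "set P = set Q \<Longrightarrow> con C P = con C Q"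
  by (simp add: con_def)

definition cheapest :: "('a set \<Rightarrow> 'a list \<Rightarrow> real) \<Rightarrow> 'a list set \<Rightarrow> 'a set list \<Rightarrow> 'a list set" where
  "cheapest c S P = {ax \<in> S. \<forall>ax' \<in> S. total_cost c P ax \<le> total_cost c P ax'}"

lemma argmin_axes_eq_cheapest: "argmin_axes c C P = cheapest c (axes C) P"
  by (auto simp: argmin_axes_def cheapest_def)

lemma cheapest_cong:
  "(\<And>ax. ax \<in> S \<Longrightarrow> total_cost c P ax = total_cost c' P' ax) \<Longrightarrow> cheapest c S P = cheapest c' S P'"
  by (auto simp: cheapest_def)

lemma cheapest_image:
  assumes "\<And>ax. ax \<in> S \<Longrightarrow> total_cost c P ax = total_cost c' P' (\<rho> ax)"
  shows "cheapest c' (\<rho> ` S) P' = \<rho> ` cheapest c S P"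
  using assms by (auto simp: cheapest_def)

lemma cheapest_single: "ax \<in> cheapest c S [A] \<longleftrightarrow> ax \<in> S \<and> (\<forall>bx \<in> S. c A ax \<le> c A bx)"
  by (auto simp: cheapest_def)

lemma cheapest_eq_if_subset:
  assumes "T \<subseteq> S" "cheapest c S P \<subseteq> T" "cheapest c S P \<noteq> {}"
  shows "cheapest c S P = cheapest c T P"
proof
  show "cheapest c S P \<subseteq> cheapest c T P" using assms(1,2) by (auto simp: cheapest_def)
next
  obtain best where best: "best \<in> cheapest c S P" using assms(3) by blast
  show "cheapest c T P \<subseteq> cheapest c S P"
  proof
    fix ax assume ax: "ax \<in> cheapest c T P"
    moreover have "best \<in> T" using best assms(2) by blast
    ultimately have "total_cost c P ax \<le> total_cost c P best" by (simp add: cheapest_def)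
    then show "ax \<in> cheapest c S P" using ax best assms(1) by (force simp: cheapest_def)
  qed
qed

definition normal_cost :: "'a axis_rule \<Rightarrow> 'a set \<Rightarrow> ('a set \<Rightarrow> 'a list \<Rightarrow> real) \<Rightarrow> bool" where
  "normal_cost f C c \<longleftrightarrow> induced_on f C c \<and>
     (\<forall>A ax. A \<noteq> {} \<longrightarrow> A \<subseteq> C \<longrightarrow> is_axis C ax \<longrightarrow>
        0 \<le> c A ax \<and> (c A ax = 0 \<longleftrightarrow> is_interval A ax))"

lemma normal_costI:
  assumes "\<And>P. is_profile C P \<Longrightarrow> f C P = cheapest c (axes C) P"
    and "\<And>A ax. A \<noteq> {} \<Longrightarrow> A \<subseteq> C \<Longrightarrow> is_axis C ax \<Longrightarrow> 0 \<le> c A ax \<and> (c A ax = 0 \<longleftrightarrow> is_interval A ax)"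
  shows "normal_cost f C c"
  using assms by (simp add: normal_cost_def induced_on_def argmin_axes_eq_cheapest)

lemma rule_eq_cheapest:
  "normal_cost f C c \<Longrightarrow> is_profile C P \<Longrightarrow> f C P = cheapest c (axes C) P"
  by (simp add: normal_cost_def induced_on_def argmin_axes_eq_cheapest)

lemma normal_cost_nonneg:
  "normal_cost f C c \<Longrightarrow> A \<noteq> {} \<Longrightarrow> A \<subseteq> C \<Longrightarrow> is_axis C ax \<Longrightarrow> 0 \<le> c A ax"
  and normal_cost_eq_0_iff:
  "normal_cost f C c \<Longrightarrow> A \<noteq> {} \<Longrightarrow> A \<subseteq> C \<Longrightarrow> is_axis C ax \<Longrightarrow> c A ax = 0 \<longleftrightarrow> is_interval A ax"
  by (simp_all add: normal_cost_def)

lemma normal_cost_cong: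
  assumes "normal_cost f C c"
    and eq: "\<And>A ax. A \<noteq> {} \<Longrightarrow> A \<subseteq> C \<Longrightarrow> is_axis C ax \<Longrightarrow> c' A ax = c A ax"
  shows "normal_cost f C c'"
proof (rule normal_costI)
  fix P assume P: "is_profile C P"
  have "total_cost c' P ax = total_cost c P ax" if "is_axis C ax" for ax
    using P by (induction P) (auto simp: eq that)
  then show "f C P = cheapest c' (axes C) P"
    using rule_eq_cheapest[OF assms(1) P] cheapest_cong[of "axes C" c P c' P] by simp
qed (use assms in \<open>auto simp: eq normal_cost_def\<close>)

lemma normal_cost_divide:
  assumes "normal_cost f C c" "0 < (k :: real)"
  shows "normal_cost f C (\<lambda>A ax. c A ax / k)"
proof (rule normal_costI)
  fix P assume P: "is_profile C P"
  have "total_cost (\<lambda>A ax. c A ax / k) P ax = total_cost c P ax / k" for ax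
    by (induction P) (auto simp: add_divide_distrib)
  then show "f C P = cheapest (\<lambda>A ax. c A ax / k) (axes C) P"
    using rule_eq_cheapest[OF assms(1) P] assms(2) by (simp add: cheapest_def divide_le_cancel)
qed (use assms in \<open>auto simp: normal_cost_def\<close>)

lemma total_cost_nonneg:
  assumes "normal_cost f C c" "is_profile C P" "is_axis C ax"
  shows "0 \<le> total_cost c P ax"
  using assms(2) normal_cost_nonneg[OF assms(1) _ _ assms(3)] by (induction P) auto

lemma total_cost_eq_0_iff:
  assumes "normal_cost f C c" "is_profile C P" "is_axis C ax"
  shows "total_cost c P ax = 0 \<longleftrightarrow> ax \<in> con C P"
  using assms(2)
proof (induction P)
  case (Cons A P)
  then have "0 \<le> total_cost c P ax" "0 \<le> c A ax" "c A ax = 0 \<longleftrightarrow> is_interval A ax"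
    using total_cost_nonneg[OF assms(1) _ assms(3)] normal_cost_nonneg[OF assms(1) _ _ assms(3)]
      normal_cost_eq_0_iff[OF assms(1) _ _ assms(3)] by auto
  then show ?case using Cons by (auto simp: con_def add_nonneg_eq_0_iff)
qed (simp add: con_def assms(3))

lemma ex_nat_multiples_exceed:
  fixes t :: "'b \<Rightarrow> real"
  assumes "finite S" "\<And>x. x \<in> S \<Longrightarrow> 0 < t x"
  obtains k :: nat where "0 < k" "\<And>x. x \<in> S \<Longrightarrow> T < real k * t x"
proof -
  have "\<forall>x \<in> S. eventually (\<lambda>k. T < real k * t x) sequentially"
  proof
    fix x assume "x \<in> S"
    moreover have "eventually (\<lambda>k. T / t x < real k) sequentially"
      using filterlim_real_sequentially unfolding filterlim_at_top_dense by blast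
    ultimately show "eventually (\<lambda>k. T < real k * t x) sequentially"
      using assms(2) by (simp add: pos_divide_less_eq)
  qed
  then have "eventually (\<lambda>k. \<forall>x \<in> S. T < real k * t x) sequentially"
    using assms(1) by (simp add: eventually_ball_finite)
  from eventually_happens'[OF sequentially_bot eventually_conj[OF eventually_gt_at_top[of 0] this]]
  show ?thesis using that by auto
qed

locale linear_scoring_rule =
  fixes f :: "'a axis_rule"
  assumes axis_rule: "is_axis_rule f"
    and scoring: "scoring_rule f"
    and linearity: "consistent_with_linearity f"
begin

lemma rule_nonempty: "finite C \<Longrightarrow> is_profile C P \<Longrightarrow> f C P \<noteq> {}"
  and is_axis_if_in_rule: "finite C \<Longrightarrow> is_profile C P \<Longrightarrow> ax \<in> f C P \<Longrightarrow> is_axis C ax"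
  and rev_in_rule: "finite C \<Longrightarrow> is_profile C P \<Longrightarrow> ax \<in> f C P \<Longrightarrow> rev ax \<in> f C P"
  using axis_rule unfolding is_axis_rule_def axes_def by blast+

lemma rule_single_ballot:
  assumes "finite C" "A \<noteq> {}" "A \<subseteq> C"
  shows "f C [A] = con C [A]" "con C [A] \<noteq> {}"
proof -
  show "con C [A] \<noteq> {}" using ex_axis_is_interval assms(1,3) by (auto simp: con_def)
  then show "f C [A] = con C [A]"
    using linearity assms by (simp add: consistent_with_linearity_def linear_profile_def)
qed

lemma ex_normal_cost:
  assumes "finite C"
  obtains c where "normal_cost f C c"
proof -
  obtain c where c: "\<And>P. is_profile C P \<Longrightarrow> f C P = cheapest c (axes C) P"
  proof -
    obtain c where "induced_on f C c" using scoring assms unfolding scoring_rule_def by blast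
    then show ?thesis using that by (simp add: induced_on_def argmin_axes_eq_cheapest)
  qed
  define best where "best A = (SOME ax. ax \<in> f C [A])" for A
  define c' where "c' A ax = c A ax - c A (best A)" for A ax
  have "normal_cost f C c'"
  proof (rule normal_costI)
    fix P assume "is_profile C P"
    moreover have "total_cost c' P ax = total_cost c P ax - (\<Sum>A\<leftarrow>P. c A (best A))" for ax
      by (induction P) (auto simp: c'_def)
    ultimately show "f C P = cheapest c' (axes C) P" using c by (simp add: cheapest_def)
  next
    fix A ax assume A: "A \<noteq> {}" "A \<subseteq> C" and ax: "is_axis C ax"
    have "best A \<in> f C [A]"
      using rule_single_ballot[OF assms A] unfolding best_def by (simp add: some_in_eq)
    moreover have "f C [A] = {ax. is_axis C ax \<and> (\<forall>ax'. is_axis C ax' \<longrightarrow> c A ax \<le> c A ax')}"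
      using c A by (auto simp: cheapest_def)
    ultimately have "c A (best A) \<le> c A ax" "c A ax = c A (best A) \<longleftrightarrow> ax \<in> f C [A]"
      using ax by (auto intro: order.antisym)
    then show "0 \<le> c' A ax \<and> (c' A ax = 0 \<longleftrightarrow> is_interval A ax)"
      using rule_single_ballot(1)[OF assms A] ax by (auto simp: c'_def con_def)
  qed
  then show ?thesis using that by blast
qed

text \<open>Repeating the ballots of \<open>L\<close> often enough makes every axis outside \<open>con C L\<close> too expensive.\<close>

lemma ex_forcing_profile:
  assumes fin: "finite C" and L: "is_profile C L" "con C L \<noteq> {}" and P: "is_profile C P"
  obtains Q where "set Q = set L"
    "\<And>c. normal_cost f C c \<Longrightarrow> f C (Q @ P) = cheapest c (con C L) P"
proof -
  obtain c where c: "normal_cost f C c" using ex_normal_cost[OF fin] .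
  obtain ax0 where ax0: "ax0 \<in> con C L" using L(2) by blast
  have "0 < total_cost c L ax" if "ax \<in> axes C - con C L" for ax
    using that total_cost_nonneg[OF c L(1)] total_cost_eq_0_iff[OF c L(1)] by (auto simp: less_le)
  then obtain k :: nat where k: "0 < k"
    "\<And>ax. ax \<in> axes C - con C L \<Longrightarrow> total_cost c P ax0 < real k * total_cost c L ax"
    using ex_nat_multiples_exceed[of "axes C - con C L" "total_cost c L" "total_cost c P ax0"]
      finite_axes[OF fin] by blast
  define Q where "Q = concat (replicate k L)"
  have Q: "set Q = set L" using k(1) by (auto simp: Q_def)
  have QP: "is_profile C (Q @ P)" using L P is_profile_cong[OF Q] by simp
  have "f C (Q @ P) \<subseteq> con C L"
  proof
    fix ax assume "ax \<in> f C (Q @ P)"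
    then have ax: "is_axis C ax" "total_cost c (Q @ P) ax \<le> total_cost c (Q @ P) ax0"
      using ax0 unfolding rule_eq_cheapest[OF c QP] by (auto simp: cheapest_def con_def)
    then have "real k * total_cost c L ax \<le> total_cost c P ax0"
      using total_cost_nonneg[OF c P] total_cost_eq_0_iff[OF c L(1), of ax0] ax0
      by (fastforce simp: Q_def con_def)
    then show "ax \<in> con C L" using k(2)[of ax] ax(1) by fastforce
  qed
  have "f C (Q @ P) = cheapest c (con C L) P" if c: "normal_cost f C c" for c
  proof -
    have free: "total_cost c Q ax = 0" if "ax \<in> con C L" for ax
      using total_cost_eq_0_iff[OF c L(1), of ax] that by (simp add: Q_def con_def)
    have "f C (Q @ P) = cheapest c (con C L) (Q @ P)"
      using \<open>f C (Q @ P) \<subseteq> con C L\<close> rule_nonempty[OF fin QP] unfolding rule_eq_cheapest[OF c QP]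
      by (intro cheapest_eq_if_subset) (auto simp: con_def)
    also have "\<dots> = cheapest c (con C L) P" by (intro cheapest_cong) (simp add: free)
    finally show ?thesis .
  qed
  then show ?thesis using that Q by blast
qed

lemma normal_cost_rev:
  assumes fin: "finite C" and c: "normal_cost f C c" and A: "A \<noteq> {}" "A \<subseteq> C" and ax: "is_axis C ax"
  shows "c A (rev ax) = c A ax"
proof -
  have L: "is_profile C (rigid ax)"
    using is_profile_block_cuts[of "[]" "[]" ax C] ax by (simp add: is_axis_def)
  obtain Q where Q: "set Q = set (rigid ax)"
    "\<And>c. normal_cost f C c \<Longrightarrow> f C (Q @ [A]) = cheapest c {ax, rev ax} [A]"
  proof (rule ex_forcing_profile[OF fin L])
    show "con C (rigid ax) \<noteq> {}" "is_profile C [A]" using con_rigid[OF ax] A by simp_all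
  qed (simp add: con_rigid[OF ax])
  have QA: "is_profile C (Q @ [A])" using L A is_profile_cong[OF Q(1)] by simp
  obtain best where "best \<in> f C (Q @ [A])" "rev best \<in> f C (Q @ [A])"
    using rule_nonempty[OF fin QA] rev_in_rule[OF fin QA] by blast
  then show ?thesis unfolding Q(2)[OF c] by (auto simp: cheapest_def)
qed

lemma total_cost_rev:
  assumes "finite C" "normal_cost f C c" "is_profile C P" "is_axis C ax"
  shows "total_cost c P (rev ax) = total_cost c P ax"
  using assms(3) normal_cost_rev[OF assms(1,2) _ _ assms(4)] by (induction P) auto

end

section \<open>Uniqueness of normalised costs\<close>

lemma eq_if_same_nat_ratios_above:
  fixes r s :: real
  assumes "0 \<le> r" "0 \<le> s"
    and "\<And>p q :: nat. 0 < q \<Longrightarrow> r < real p / real q \<longleftrightarrow> s < real p / real q"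
  shows "r = s"
proof -
  have "\<not> r < s" if "0 \<le> r" "\<And>p q :: nat. 0 < q \<Longrightarrow> r < real p / real q \<Longrightarrow> s < real p / real q"
    for r s :: real
  proof
    assume "r < s"
    then obtain t where t: "t \<in> \<rat>" "r < t" "t < s" using Rats_dense_in_real by blast
    then have "\<bar>t\<bar> = t" using that(1) by simp
    with t(1) obtain p q :: nat where "q \<noteq> 0" "t = real p / real q" by (metis Rats_abs_nat_div_natE)
    then show False using that(2)[of q p] t by auto
  qed
  from this[of r s] this[of s r] show ?thesis using assms by force
qed

lemma cross_proportional_if_same_signs:
  fixes d d' :: "'b \<Rightarrow> real"
  assumes same: "\<And>P. set P \<subseteq> D \<Longrightarrow> 0 < (\<Sum>A\<leftarrow>P. d A) \<longleftrightarrow> 0 < (\<Sum>A\<leftarrow>P. d' A)"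
    and A: "A \<in> D" "0 < d A" and B: "B \<in> D" "d B \<le> 0"
  shows "d' A * d B = d A * d' B"
proof -
  have A': "0 < d' A" and B': "d' B \<le> 0" using same[of "[A]"] same[of "[B]"] A B by simp_all
  have "- d B / d A = - d' B / d' A"
  proof (rule eq_if_same_nat_ratios_above)
    fix p q :: nat assume "0 < q"
    then have "- e B / e A < real p / real q \<longleftrightarrow> 0 < (\<Sum>E\<leftarrow>replicate p A @ replicate q B. e E)"
      if "0 < e A" for e :: "'b \<Rightarrow> real"
      using that by (auto simp: sum_list_replicate field_simps)
    then show "- d B / d A < real p / real q \<longleftrightarrow> - d' B / d' A < real p / real q"
      using same[of "replicate p A @ replicate q B"] A B A' by (auto simp: set_replicate_conv_if)
  qed (use A B A' B' in \<open>simp_all add: divide_nonpos_pos\<close>)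
  then show ?thesis using A A' by (simp add: field_simps)
qed

lemma proportional_if_same_signs:
  fixes d d' :: "'b \<Rightarrow> real"
  assumes same: "\<And>P. set P \<subseteq> D \<Longrightarrow> 0 < (\<Sum>A\<leftarrow>P. d A) \<longleftrightarrow> 0 < (\<Sum>A\<leftarrow>P. d' A)"
    and A: "A \<in> D" "0 < d A" and B: "B \<in> D" "d B < 0"
  obtains \<alpha> where "0 < \<alpha>" "\<And>E. E \<in> D \<Longrightarrow> d' E = \<alpha> * d E"
proof
  show "0 < d' A / d A" using same[of "[A]"] A by simp
  fix E assume E: "E \<in> D"
  note cross = cross_proportional_if_same_signs[of D d d', OF same]
  show "d' E = d' A / d A * d E"
  proof (cases "d E \<le> 0")
    case True
    then show ?thesis using cross[of A E] A E by (simp add: field_simps)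
  next
    case False
    then have "d' E * d B = d E * d' B" using cross[of E B] E B by simp
    then have "d' E * d A * d B = d E * d' A * d B"
      using cross[of A B] A B
      by (metis (no_types, opaque_lifting) less_imp_le mult.assoc mult.commute)
    then show ?thesis using A B by (simp add: field_simps)
  qed
qed

definition swap_at :: "nat \<Rightarrow> 'b list \<Rightarrow> 'b list" where
  "swap_at i xs = xs[i := xs ! Suc i, Suc i := xs ! i]"

lemma swap_at_append [simp]: "swap_at (length u) (u @ x # y # v) = u @ y # x # v"
  by (simp add: swap_at_def nth_append list_update_append)

lemma is_axis_swap_at: "is_axis C ax \<Longrightarrow> Suc i < card C \<Longrightarrow> is_axis C (swap_at i ax)"
  using length_axis[of C ax] by (simp add: is_axis_def swap_at_def)

lemma split_list_at_pair:
  assumes "Suc i < length xs"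
  obtains u x y v where "xs = u @ x # y # v" "length u = i"
  using assms that[of "take i xs" "xs ! i" "xs ! Suc i" "drop (Suc (Suc i)) xs"]
  by (simp add: Cons_nth_drop_Suc)

lemma swap_at_swap_at: "Suc i < length xs \<Longrightarrow> swap_at i (swap_at i xs) = xs"
  by (auto elim!: split_list_at_pair)

lemma distinct_set_pair_iff:
  assumes "x \<noteq> y"
  shows "distinct xs \<and> set xs = {x, y} \<longleftrightarrow> xs = [x, y] \<or> xs = [y, x]"
proof
  assume xs: "distinct xs \<and> set xs = {x, y}"
  then have "length xs = 2" using assms by (metis distinct_card card_2_iff)
  then obtain p q where "xs = [p, q]" by (auto simp: length_Suc_conv numeral_2_eq_2)
  then show "xs = [x, y] \<or> xs = [y, x]" using xs by (auto simp: doubleton_eq_iff)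
qed (use assms in auto)

lemma block_axes_pair: "x \<noteq> y \<Longrightarrow> block_axes u [x, y] v = {u @ x # y # v, u @ y # x # v}"
proof -
  assume "x \<noteq> y"
  then have "{xs. distinct xs \<and> set xs = {x, y}} = {[x, y], [y, x]}"
    by (intro set_eqI) (simp add: distinct_set_pair_iff)
  then show ?thesis by (simp add: block_axes_def setcompr_eq_image)
qed

lemma adjacent_swaps_connect:
  assumes swap: "\<And>u x y v. \<phi> (u @ x # y # v) \<Longrightarrow> \<phi> (u @ y # x # v)"
    and "\<phi> (u @ xs)" "distinct xs" "distinct ys" "set xs = set ys"
  shows "\<phi> (u @ ys)"
  using assms(2-)
proof (induction ys arbitrary: u xs)
  case (Cons y ys)
  obtain p q where xs: "xs = p @ y # q" using Cons.prems by (metis list.set_intros(1) split_list)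
  have "\<phi> (u @ p @ y # q) \<Longrightarrow> \<phi> (u @ y # p @ q)" for p q
  proof (induction p arbitrary: q rule: rev_induct)
    case (snoc z p)
    then show ?case using swap[of "u @ p" z y q] by simp
  qed auto
  then have "\<phi> ((u @ [y]) @ (p @ q))" using Cons.prems xs by simp
  moreover have "set (p @ q) = set ys" using Cons.prems xs by auto
  ultimately show ?case using Cons.IH[of "u @ [y]" "p @ q"] Cons.prems xs by auto
qed auto

lemma axis_swap_induct:
  assumes "is_axis C ax" "is_axis C bx" "\<phi> ax"
    and swap: "\<And>cx i. is_axis C cx \<Longrightarrow> Suc i < card C \<Longrightarrow> \<phi> cx \<Longrightarrow> \<phi> (swap_at i cx)"
  shows "\<phi> bx"
proof -
  define \<psi> where "\<psi> cx \<longleftrightarrow> is_axis C cx \<and> \<phi> cx" for cx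
  have "\<psi> (u @ y # x # v)" if "\<psi> (u @ x # y # v)" for u x y v
  proof -
    have axis: "is_axis C (u @ x # y # v)" using that by (simp add: \<psi>_def)
    then have i: "Suc (length u) < card C" using length_axis[OF axis] by simp
    show ?thesis
      using swap[OF axis i] is_axis_swap_at[OF axis i] that by (simp add: \<psi>_def)
  qed
  moreover have "\<psi> ([] @ ax)" using assms(1,3) by (simp add: \<psi>_def)
  ultimately have "\<psi> ([] @ bx)"
    by (rule adjacent_swaps_connect) (use assms(1,2) in \<open>simp_all add: is_axis_def\<close>)
  then show ?thesis by (simp add: \<psi>_def)
qed

lemma ex_ballot_interval_after_swap:
  assumes "is_axis C ax" "3 \<le> card C" "Suc i < card C"
  obtains A where "A \<noteq> {}" "A \<subseteq> C" "\<not> is_interval A ax" "is_interval A (swap_at i ax)"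
proof -
  obtain u x y v where ax: "ax = u @ x # y # v" "length u = i"
    using split_list_at_pair[of i ax] assms(1,3) length_axis by metis
  then have swap: "swap_at i ax = u @ y # x # v" by auto
  have dist: "distinct (u @ x # y # v)" "set (u @ x # y # v) = C"
    using assms(1) ax(1) by (auto simp: is_axis_def)
  show ?thesis
  proof (cases v)
    case (Cons z w)
    then show ?thesis
      using that[of "{x, z}", unfolded swap, unfolded ax(1)]
        not_is_interval_separated_pair[of u x y z w]
        is_interval_adjacent_pair[of "u @ [y]" x z w] dist by auto
  next
    case Nil
    then have "u \<noteq> []" using length_axis[OF assms(1)] assms(2) ax by auto
    then obtain t z where "u = t @ [z]" by (metis rev_exhaust)
    then show ?thesis
      using that[of "{z, y}", unfolded swap, unfolded ax(1)]
        not_is_interval_separated_pair[of t z x y v]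
        is_interval_adjacent_pair[of t z y "x # v"] dist by auto
  qed
qed

definition scales_difference ::
    "('a set \<Rightarrow> 'a list \<Rightarrow> real) \<Rightarrow> ('a set \<Rightarrow> 'a list \<Rightarrow> real) \<Rightarrow>
      'a set \<Rightarrow> real \<Rightarrow> 'a list \<Rightarrow> 'a list \<Rightarrow> bool"
  where "scales_difference c c' C \<alpha> ax bx \<longleftrightarrow>
    (\<forall>A. A \<noteq> {} \<longrightarrow> A \<subseteq> C \<longrightarrow> c' A ax - c' A bx = \<alpha> * (c A ax - c A bx))"

lemma scales_difference_commute:
  "scales_difference c c' C \<alpha> ax bx \<longleftrightarrow> scales_difference c c' C \<alpha> bx ax"
  unfolding scales_difference_def by (metis minus_diff_eq mult_minus_right)

text \<open>A ballot that is an interval of \<open>bx\<close> and \<open>bx'\<close> but not of \<open>ax\<close> determines the factor as the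
  ratio of its costs on \<open>ax\<close>.\<close>

lemma scales_difference_factor_eq:
  assumes c: "normal_cost f C c" and c': "normal_cost f C c'"
    and axes: "is_axis C ax" "is_axis C bx" "is_axis C bx'"
    and A: "A \<noteq> {}" "A \<subseteq> C" "\<not> is_interval A ax" "is_interval A bx" "is_interval A bx'"
    and scales: "scales_difference c c' C \<alpha> ax bx" "scales_difference c c' C \<beta> ax bx'"
  shows "\<alpha> = \<beta>"
proof -
  have "c A ax \<noteq> 0" "c A bx = 0" "c A bx' = 0" "c' A bx = 0" "c' A bx' = 0"
    using normal_cost_eq_0_iff[OF c A(1,2)] normal_cost_eq_0_iff[OF c' A(1,2)] axes A by auto
  moreover have "c' A ax - c' A bx = \<alpha> * (c A ax - c A bx)"
    "c' A ax - c' A bx' = \<beta> * (c A ax - c A bx')"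
    using scales A(1,2) by (simp_all add: scales_difference_def)
  ultimately show ?thesis by simp
qed

lemma consecutive_swap_factors_eq:
  assumes c: "normal_cost f C c" and c': "normal_cost f C c'"
    and ax: "is_axis C ax" and i: "Suc (Suc i) < card C"
    and scales: "scales_difference c c' C \<alpha> ax (swap_at (Suc i) ax)"
      "scales_difference c c' C \<beta> ax (swap_at i ax)"
  shows "\<alpha> = \<beta>"
proof -
  obtain u x y w where "ax = u @ x # y # w" and u: "length u = i"
    using split_list_at_pair[of i ax] length_axis[OF ax] i Suc_lessD by metis
  moreover from this obtain z v where "w = z # v" using length_axis[OF ax] i by (cases w) auto
  ultimately have ax_eq: "ax = u @ x # y # z # v" by simp
  then have swaps: "swap_at i ax = u @ y # x # z # v" "swap_at (Suc i) ax = u @ x # z # y # v"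
    using swap_at_append[of u x y "z # v"] swap_at_append[of "u @ [x]" y z v] u by simp_all
  have dist: "distinct ax" "set ax = C" using ax by (auto simp: is_axis_def)
  show ?thesis
  proof (rule scales_difference_factor_eq[OF c c' ax _ _ _ _ _ _ _ scales])
    show "\<not> is_interval {x, z} ax" "{x, z} \<subseteq> C"
      using not_is_interval_separated_pair[of u x y z v] dist by (auto simp: ax_eq)
    show "is_interval {x, z} (swap_at (Suc i) ax)" "is_interval {x, z} (swap_at i ax)"
      unfolding swaps
      using is_interval_adjacent_pair[of u x z "y # v"]
        is_interval_adjacent_pair[of "u @ [y]" x z v] dist
      by (auto simp: ax_eq)
  qed (use is_axis_swap_at[OF ax] i in auto)
qed

context linear_scoring_rule
begin

lemma swap_preference_eq:
  assumes fin: "finite C" and c: "normal_cost f C c" and c': "normal_cost f C c'"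
    and P: "is_profile C P" and ax: "is_axis C ax" and i: "Suc i < card C"
  shows "total_cost c P ax \<le> total_cost c P (swap_at i ax) \<longleftrightarrow>
    total_cost c' P ax \<le> total_cost c' P (swap_at i ax)"
proof -
  obtain u x y v where uxyv: "ax = u @ x # y # v" "length u = i"
    using split_list_at_pair[of i ax] i length_axis[OF ax] by metis
  have dist: "distinct (u @ [x, y] @ v)" "C = set (u @ [x, y] @ v)"
    using ax uxyv(1) by (auto simp: is_axis_def)
  define bx where "bx = swap_at i ax"
  have bx: "bx = u @ y # x # v" "is_axis C bx"
    using uxyv is_axis_swap_at[OF ax i] by (auto simp: bx_def)
  have block: "block_axes u [x, y] v = {ax, bx}"
    using block_axes_pair[of x y u v] dist(1) by (simp add: uxyv(1) bx(1))
  have con: "con C (block_cuts u [x, y] v) = {ax, bx, rev ax, rev bx}"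
    using con_block_cuts[OF dist] by (auto simp: block)
  obtain Q where Q: "\<And>c. normal_cost f C c \<Longrightarrow> f C (Q @ P) = cheapest c {ax, bx, rev ax, rev bx} P"
    using ex_forcing_profile[OF fin is_profile_block_cuts _ P, of u "[x, y]" v] dist(2) con
    by (metis insert_not_empty order.refl)
  have "ax \<in> f C (Q @ P) \<longleftrightarrow> total_cost c P ax \<le> total_cost c P bx" if "normal_cost f C c" for c
    using Q[OF that] total_cost_rev[OF fin that P] ax bx(2) by (auto simp: cheapest_def)
  then show ?thesis using c c' unfolding bx_def by blast
qed

lemma ex_swap_scaling:
  assumes fin: "finite C" and card: "3 \<le> card C"
    and c: "normal_cost f C c" and c': "normal_cost f C c'"
    and ax: "is_axis C ax" and i: "Suc i < card C"
  shows "\<exists>\<alpha>>0. scales_difference c c' C \<alpha> ax (swap_at i ax)"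
proof -
  define bx where "bx = swap_at i ax"
  define D where "D = {A. A \<noteq> {} \<and> A \<subseteq> C}"
  define d where "d c A = c A ax - c A bx" for c :: "'a set \<Rightarrow> 'a list \<Rightarrow> real" and A
  have bx: "is_axis C bx" "swap_at i bx = ax"
    using is_axis_swap_at[OF ax i] swap_at_swap_at[of i ax] i length_axis[OF ax]
    by (auto simp: bx_def)
  have same: "0 < (\<Sum>A\<leftarrow>P. d c A) \<longleftrightarrow> 0 < (\<Sum>A\<leftarrow>P. d c' A)" if "set P \<subseteq> D" for P
  proof -
    have "is_profile C P" using that by (auto simp: D_def is_profile_def)
    moreover have "(\<Sum>A\<leftarrow>P. d c A) = total_cost c P ax - total_cost c P bx" for c
      by (induction P) (auto simp: d_def)
    ultimately show ?thesis
      using swap_preference_eq[OF fin c c' _ ax i, of P] by (auto simp: bx_def)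
  qed
  have cheaper: "c A ay < c A az"
    if "A \<noteq> {}" "A \<subseteq> C" "is_axis C ay" "is_axis C az" "is_interval A ay" "\<not> is_interval A az"
    for A ay az
    using normal_cost_nonneg[OF c that(1,2,4)] normal_cost_eq_0_iff[OF c that(1,2,3)]
      normal_cost_eq_0_iff[OF c that(1,2,4)] that(5,6) by simp
  obtain A where A: "A \<noteq> {}" "A \<subseteq> C" "\<not> is_interval A ax" "is_interval A bx"
    using ex_ballot_interval_after_swap[OF ax card i] unfolding bx_def .
  obtain B where B: "B \<noteq> {}" "B \<subseteq> C" "\<not> is_interval B bx" "is_interval B ax"
    using ex_ballot_interval_after_swap[OF bx(1) card i] unfolding bx(2) .
  have "A \<in> D" "0 < d c A" "B \<in> D" "d c B < 0"
    using cheaper[OF A(1,2) bx(1) ax A(4,3)] cheaper[OF B(1,2) ax bx(1) B(4,3)] A B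
    by (simp_all add: D_def d_def)
  then obtain \<alpha> where "0 < \<alpha>" "\<And>E. E \<in> D \<Longrightarrow> d c' E = \<alpha> * d c E"
    using proportional_if_same_signs[of D "d c" "d c'", OF same] by blast
  then show ?thesis by (auto simp: D_def d_def scales_difference_def bx_def)
qed

lemma ex_common_swap_scaling:
  assumes fin: "finite C" and card: "3 \<le> card C"
    and c: "normal_cost f C c" and c': "normal_cost f C c'"
  obtains \<alpha> where "0 < \<alpha>"
    "\<And>ax i. is_axis C ax \<Longrightarrow> Suc i < card C \<Longrightarrow> scales_difference c c' C \<alpha> ax (swap_at i ax)"
proof -
  obtain F where F: "\<And>ax i. is_axis C ax \<Longrightarrow> Suc i < card C \<Longrightarrow>
      0 < F ax i \<and> scales_difference c c' C (F ax i) ax (swap_at i ax)"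
    using ex_swap_scaling[OF assms] by metis
  have "F ax (Suc i) = F ax i" if "is_axis C ax" "Suc (Suc i) < card C" for ax i
    using consecutive_swap_factors_eq[OF c c' that] F that by (metis Suc_lessD)
  then have position: "F ax i = F ax 0" if "is_axis C ax" "Suc i < card C" for ax i
    using that(2) by (induction i) (auto simp: that(1))
  have swap: "F (swap_at i ax) 0 = F ax 0" if ax: "is_axis C ax" and i: "Suc i < card C" for ax i
  proof -
    let ?bx = "swap_at i ax"
    have bx: "is_axis C ?bx" "swap_at i ?bx = ax"
      using is_axis_swap_at[OF ax i] swap_at_swap_at[of i ax] length_axis[OF ax] i by auto
    obtain A where "A \<noteq> {}" "A \<subseteq> C" "\<not> is_interval A ?bx" "is_interval A ax"
      using ex_ballot_interval_after_swap[OF bx(1) card i] bx(2) by metis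
    then have "F ?bx i = F ax i"
      using scales_difference_factor_eq[OF c c' bx(1) ax ax] F[OF ax i] F[OF bx(1) i] bx(2)
      by (simp add: scales_difference_commute)
    then show ?thesis using position ax bx(1) i by metis
  qed
  obtain ax0 where ax0: "is_axis C ax0" using ex_axis[OF fin] by blast
  have "F ax 0 = F ax0 0" if "is_axis C ax" for ax
    using axis_swap_induct[of C ax0 ax "\<lambda>ax. F ax 0 = F ax0 0"] ax0 that swap by simp
  moreover have "0 < F ax0 0" using F[OF ax0, of 0] card by simp
  ultimately show ?thesis using that[of "F ax0 0"] F position by metis
qed

lemma normal_cost_unique:
  assumes fin: "finite C" and card: "3 \<le> card C"
    and c: "normal_cost f C c" and c': "normal_cost f C c'"
  obtains \<alpha> where "0 < \<alpha>"
    "\<And>A ax. A \<noteq> {} \<Longrightarrow> A \<subseteq> C \<Longrightarrow> is_axis C ax \<Longrightarrow> c' A ax = \<alpha> * c A ax"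
proof -
  obtain \<alpha> where \<alpha>: "0 < \<alpha>"
    "\<And>ax i. is_axis C ax \<Longrightarrow> Suc i < card C \<Longrightarrow> scales_difference c c' C \<alpha> ax (swap_at i ax)"
    using ex_common_swap_scaling[OF assms] by blast
  have "c' A ax = \<alpha> * c A ax" if A: "A \<noteq> {}" "A \<subseteq> C" and ax: "is_axis C ax" for A ax
  proof -
    obtain ax1 where ax1: "is_axis C ax1" "is_interval A ax1"
      using ex_axis_is_interval[OF fin A(2)] by blast
    show ?thesis
    proof (rule axis_swap_induct[OF ax1(1) ax])
      show "c' A ax1 = \<alpha> * c A ax1"
        using normal_cost_eq_0_iff[OF c A ax1(1)] normal_cost_eq_0_iff[OF c' A ax1(1)] ax1(2)
        by simp
      fix bx i assume bx: "is_axis C bx" "Suc i < card C" "c' A bx = \<alpha> * c A bx"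
      have "c' A bx - c' A (swap_at i bx) = \<alpha> * (c A bx - c A (swap_at i bx))"
        using \<alpha>(2)[OF bx(1,2)] A by (simp add: scales_difference_def)
      then show "c' A (swap_at i bx) = \<alpha> * c A (swap_at i bx)"
        using bx(3) by (simp add: right_diff_distrib)
    qed
  qed
  then show ?thesis using that \<alpha>(1) by blast
qed

end

section \<open>Neutrality and costs of words\<close>

definition word_cost :: "(bool list \<Rightarrow> real) \<Rightarrow> 'a set \<Rightarrow> 'a list \<Rightarrow> real" where
  [simp]: "word_cost g A ax = g (word A ax)"

lemma normal_word_cost_pos:
  assumes "finite C" "normal_cost f C (word_cost g)" "length w = card C" "0 < holes w"
  shows "0 < g w"
proof -
  obtain ax where ax: "is_axis C ax" using ex_axis[OF assms(1)] by blast
  then obtain A where A: "A \<subseteq> C" "word A ax = w"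
    using ex_ballot_word[of ax w] length_axis assms(3) by (metis is_axis_def)
  then have "\<not> is_interval A ax"
    using is_interval_iff_holes[of ax A] ax assms(4) by (simp add: is_axis_def)
  moreover from this have "A \<noteq> {}" by (auto simp: is_interval_def)
  ultimately show ?thesis
    using normal_cost_nonneg[OF assms(2) _ A(1) ax] normal_cost_eq_0_iff[OF assms(2) _ A(1) ax] A(2)
    by (simp add: less_le)
qed

lemma ex_bij_map:
  assumes "distinct xs" "distinct ys" "length xs = length ys"
  obtains \<sigma> where "map \<sigma> xs = ys" "bij_betw \<sigma> (set xs) (set ys)"
proof -
  let ?\<sigma> = "\<lambda>x. the (map_of (zip xs ys) x)"
  have "map ?\<sigma> xs = ys"
    using assms by (auto intro!: nth_equalityI simp: map_of_zip_nth)
  moreover from this have "bij_betw ?\<sigma> (set xs) (set ys)"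
    using assms by (metis bij_betw_def distinct_map set_map)
  ultimately show ?thesis using that by blast
qed

lemma word_map:
  assumes "inj_on \<sigma> C" "A \<subseteq> C" "set ax \<subseteq> C"
  shows "word (\<sigma> ` A) (map \<sigma> ax) = word A ax"
  using assms by (auto simp: word_def inj_on_image_mem_iff subset_iff)

lemma is_axis_map: "bij_betw \<sigma> C C' \<Longrightarrow> is_axis C ax \<Longrightarrow> is_axis C' (map \<sigma> ax)"
  by (auto simp: is_axis_def bij_betw_def distinct_map)

lemma is_interval_map:
  assumes "bij_betw \<sigma> C C'" "A \<subseteq> C" "is_axis C ax"
  shows "is_interval (\<sigma> ` A) (map \<sigma> ax) \<longleftrightarrow> is_interval A ax"
  using is_interval_iff_holes[of ax A] is_interval_iff_holes[of "map \<sigma> ax" "\<sigma> ` A"]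
    word_map[of \<sigma> C A ax] is_axis_map[OF assms(1,3)] assms by (auto simp: is_axis_def bij_betw_def)

lemma bij_betw_map_axes:
  assumes "bij_betw \<sigma> C C'"
  shows "bij_betw (map \<sigma>) (axes C) (axes C')"
proof (rule bij_betw_byWitness[where f' = "map (inv_into C \<sigma>)"])
  show "\<forall>ax \<in> axes C. map (inv_into C \<sigma>) (map \<sigma> ax) = ax"
    using assms by (auto simp: is_axis_def bij_betw_def intro!: map_idI)
  show "\<forall>ax \<in> axes C'. map \<sigma> (map (inv_into C \<sigma>) ax) = ax"
    using assms by (auto simp: is_axis_def bij_betw_def f_inv_into_f intro!: map_idI)
qed (use is_axis_map[OF assms] is_axis_map[OF bij_betw_inv_into[OF assms]] in auto)

lemma not_is_interval_ends:
  assumes "distinct ax" "3 \<le> length ax"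
  shows "\<not> is_interval {hd ax, last ax} ax"
proof
  assume "is_interval {hd ax, last ax} ax"
  then have "card (set ax) \<le> card {hd ax, last ax}"
    by (intro card_mono subset_if_is_interval_ends) auto
  also have "\<dots> \<le> 2" by (simp add: card_insert_if)
  finally show False using assms by (simp add: distinct_card)
qed

definition ends_weight :: "'a set \<Rightarrow> ('a set \<Rightarrow> 'a list \<Rightarrow> real) \<Rightarrow> real" where
  "ends_weight C c = (\<Sum>ax \<in> axes C. c {hd ax, last ax} ax)"

lemma ends_weight_pos:
  assumes "finite C" "3 \<le> card C" "normal_cost f C c"
  shows "0 < ends_weight C c"
  unfolding ends_weight_def
proof (rule sum_pos)
  show "finite (axes C)" using finite_axes[OF assms(1)] .
  show "axes C \<noteq> {}" using ex_axis[OF assms(1)] by (auto simp: axes_def)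
  fix ax assume "ax \<in> axes C"
  then have ax: "is_axis C ax" by simp
  then have "3 \<le> length ax" using length_axis assms(2) by metis
  moreover from this have "hd ax \<in> set ax" "last ax \<in> set ax" by (auto intro: hd_in_set last_in_set)
  ultimately show "0 < c {hd ax, last ax} ax"
    using normal_cost_nonneg[OF assms(3) _ _ ax, of "{hd ax, last ax}"]
      normal_cost_eq_0_iff[OF assms(3) _ _ ax, of "{hd ax, last ax}"] not_is_interval_ends[of ax] ax
    by (simp add: is_axis_def less_le)
qed

definition transport :: "('a \<Rightarrow> 'b) \<Rightarrow> ('b set \<Rightarrow> 'b list \<Rightarrow> real) \<Rightarrow> 'a set \<Rightarrow> 'a list \<Rightarrow> real" where
  "transport \<sigma> c A ax = c (\<sigma> ` A) (map \<sigma> ax)"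

lemma ends_weight_transport:
  assumes "bij_betw \<sigma> C C'" "C \<noteq> {}"
  shows "ends_weight C (transport \<sigma> c) = ends_weight C' c"
proof -
  have "\<sigma> ` {hd ax, last ax} = {hd (map \<sigma> ax), last (map \<sigma> ax)}" if "is_axis C ax" for ax
    using that assms(2) by (auto simp: is_axis_def hd_map last_map)
  then show ?thesis
    using sum.reindex_bij_betw[OF bij_betw_map_axes[OF assms(1)], of "\<lambda>ax. c {hd ax, last ax} ax"]
    by (simp add: ends_weight_def transport_def)
qed

locale neutral_linear_scoring_rule = linear_scoring_rule +
  assumes neutral: "neutral f"
begin

lemma normal_cost_transport:
  assumes fin: "finite C" and bij: "bij_betw \<sigma> C C'" and c: "normal_cost f C' c"
  shows "normal_cost f C (transport \<sigma> c)"
proof (rule normal_costI)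
  fix P assume P: "is_profile C P"
  have P': "is_profile C' (map ((`) \<sigma>) P)"
    using P image_mono[of _ C \<sigma>] bij by (simp add: is_profile_def bij_betw_def)
  have "total_cost (transport \<sigma> c) P ax = total_cost c (map ((`) \<sigma>) P) (map \<sigma> ax)" for ax
    by (induction P) (auto simp: transport_def)
  then have "map \<sigma> ` cheapest (transport \<sigma> c) (axes C) P =
      cheapest c (map \<sigma> ` axes C) (map ((`) \<sigma>) P)"
    by (intro cheapest_image[symmetric])
  also have "\<dots> = f C' (map ((`) \<sigma>) P)"
    using rule_eq_cheapest[OF c P'] bij_betw_map_axes[OF bij] by (simp add: bij_betw_def)
  also have "\<dots> = map \<sigma> ` f C P" using neutral fin bij P unfolding neutral_def by blast
  finally have "map \<sigma> ` f C P = map \<sigma> ` cheapest (transport \<sigma> c) (axes C) P" by simp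
  moreover have "f C P \<subseteq> axes C" "cheapest (transport \<sigma> c) (axes C) P \<subseteq> axes C"
    using is_axis_if_in_rule[OF fin P] by (auto simp: cheapest_def)
  ultimately show "f C P = cheapest (transport \<sigma> c) (axes C) P"
    using bij_betw_imp_inj_on[OF bij_betw_map_axes[OF bij]] by (metis inj_on_image_eq_iff)
next
  fix A ax assume A: "A \<noteq> {}" "A \<subseteq> C" and ax: "is_axis C ax"
  moreover from this have "\<sigma> ` A \<noteq> {}" "\<sigma> ` A \<subseteq> C'" using bij by (auto simp: bij_betw_def)
  ultimately show "0 \<le> transport \<sigma> c A ax \<and> (transport \<sigma> c A ax = 0 \<longleftrightarrow> is_interval A ax)"
    using normal_cost_nonneg[OF c] normal_cost_eq_0_iff[OF c] is_axis_map[OF bij ax]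
      is_interval_map[OF bij A(2) ax] by (simp add: transport_def)
qed

text \<open>Both transported costs have the same \<open>ends_weight\<close>, so the factor between them is 1.\<close>

lemma normal_cost_transport_eq:
  fixes C :: "'a set"
  assumes fin: "finite C" and card: "3 \<le> card C" and \<sigma>: "bij_betw \<sigma> C C'" and \<tau>: "bij_betw \<tau> C C'"
    and c: "normal_cost f C' c" and A: "A \<noteq> {}" "A \<subseteq> C" and ax: "is_axis C ax"
  shows "transport \<tau> c A ax = transport \<sigma> c A ax"
proof -
  obtain \<alpha> where "0 < \<alpha>" and \<alpha>: "\<And>A ax. A \<noteq> {} \<Longrightarrow> A \<subseteq> C \<Longrightarrow> is_axis C ax \<Longrightarrow>
      transport \<tau> c A ax = \<alpha> * transport \<sigma> c A ax"
    using normal_cost_unique[OF fin card normal_cost_transport[OF fin \<sigma> c]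
        normal_cost_transport[OF fin \<tau> c]] by metis
  have "C \<noteq> {}" using card by auto
  then have "{hd bx, last bx} \<subseteq> C" if "is_axis C bx" for bx
    using that by (auto simp: is_axis_def)
  then have "ends_weight C (transport \<tau> c) = \<alpha> * ends_weight C (transport \<sigma> c)"
    unfolding ends_weight_def sum_distrib_left by (intro sum.cong \<alpha>) auto
  moreover have "0 < ends_weight C' c"
    using ends_weight_pos[OF _ _ c] bij_betw_finite[OF \<sigma>] bij_betw_same_card[OF \<sigma>] fin card by simp
  ultimately have "\<alpha> = 1"
    using ends_weight_transport[OF \<sigma> \<open>C \<noteq> {}\<close>] ends_weight_transport[OF \<tau> \<open>C \<noteq> {}\<close>] by simp
  then show ?thesis using \<alpha>[OF A ax] by simp
qed

lemma ex_normal_word_cost: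
  fixes C0 :: "'a set"
  assumes C0: "finite C0" "3 \<le> card C0"
  obtains g where "\<And>C. finite C \<Longrightarrow> card C = card C0 \<Longrightarrow> normal_cost f C (word_cost g)"
proof -
  obtain c where c: "normal_cost f C0 c" using ex_normal_cost[OF C0(1)] .
  obtain ax0 where ax0: "is_axis C0 ax0" using ex_axis[OF C0(1)] by blast
  define g where "g w = c (set (map fst (filter snd (zip ax0 w)))) ax0" for w
  have "normal_cost f C (word_cost g)" if C: "finite C" "card C = card C0" for C
  proof -
    obtain \<tau> where \<tau>: "bij_betw \<tau> C C0" using C C0 by (metis finite_same_card_bij)
    show ?thesis
    proof (rule normal_cost_cong[OF normal_cost_transport[OF C(1) \<tau> c]])
      fix A ax assume A: "A \<noteq> {}" "A \<subseteq> C" and ax: "is_axis C ax"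
      obtain \<sigma> where \<sigma>: "map \<sigma> ax = ax0" "bij_betw \<sigma> C C0"
        using ex_bij_map[of ax ax0] ax ax0 length_axis[OF ax] length_axis[OF ax0] C(2)
        unfolding is_axis_def by metis
      have "filter snd (zip (map \<sigma> ax) (word A ax)) = map (\<lambda>x. (\<sigma> x, True)) (filter (\<lambda>x. x \<in> A) ax)"
        by (induction ax) auto
      then have "set (map fst (filter snd (zip ax0 (word A ax)))) = \<sigma> ` A"
        using A ax by (auto simp: \<sigma>(1) is_axis_def)
      then show "word_cost g A ax = transport \<tau> c A ax"
        using normal_cost_transport_eq[OF C(1) _ \<sigma>(2) \<tau> c A ax] C(2) C0(2) \<sigma>(1)
        by (simp add: g_def transport_def)
    qed
  qed
  then show ?thesis using that by blast
qed

end

section \<open>Cloning\<close>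

primrec insert_after :: "'b \<Rightarrow> 'b \<Rightarrow> 'b list \<Rightarrow> 'b list" where
  "insert_after p a [] = []"
| "insert_after p a (x # xs) = (if x = p then x # a # xs else x # insert_after p a xs)"

definition add_clone :: "'a \<Rightarrow> 'a \<Rightarrow> 'a set \<Rightarrow> 'a set" where
  "add_clone p a A = (if p \<in> A then insert a A else A)"

definition cloned_cost :: "'a \<Rightarrow> 'a \<Rightarrow> ('a set \<Rightarrow> 'a list \<Rightarrow> real) \<Rightarrow> 'a set \<Rightarrow> 'a list \<Rightarrow> real" where
  [simp]: "cloned_cost p a c A ax = c (add_clone p a A) (insert_after p a ax)"

lemma insert_after_append: "p \<notin> set u \<Longrightarrow> insert_after p a (u @ p # v) = u @ p # a # v"
  by (induction u) auto

lemma restrict_axis_insert_after: "a \<notin> set ax \<Longrightarrow> restrict_axis a (insert_after p a ax) = ax"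
  by (induction ax) auto

lemma word_add_clone: "a \<notin> set u \<Longrightarrow> word (add_clone p a A) u = word A u"
  by (simp add: add_clone_def)

lemma split_axis_at:
  assumes "is_axis C ax" "p \<in> C" "a \<notin> C"
  obtains u v where "ax = u @ p # v" "p \<notin> set u" "a \<notin> set (u @ p # v)"
  using assms split_list_first[of p ax] by (auto simp: is_axis_def)

lemma is_axis_insert_after:
  assumes "is_axis C ax" "p \<in> C" "a \<notin> C"
  shows "is_axis (insert a C) (insert_after p a ax)"
proof -
  obtain u v where "ax = u @ p # v" "p \<notin> set u" "a \<notin> set (u @ p # v)"
    using split_axis_at[OF assms] by blast
  then show ?thesis using assms(1) by (auto simp: insert_after_append is_axis_def)
qed

lemma word_insert_after:
  assumes "A \<subseteq> C" "is_axis C (u @ p # v)" "a \<notin> C"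
  shows "word (add_clone p a A) (insert_after p a (u @ p # v)) =
    word A u @ (p \<in> A) # (p \<in> A) # word A v"
proof -
  have "p \<notin> set u" "a \<notin> set u" "a \<notin> set v" "a \<notin> A" "a \<noteq> p" using assms by (auto simp: is_axis_def)
  then show ?thesis
    by (auto simp: insert_after_append word_add_clone) (auto simp: add_clone_def split: if_splits)
qed

lemma is_interval_insert_after:
  assumes "A \<subseteq> C" "is_axis C ax" "p \<in> C" "a \<notin> C"
  shows "is_interval (add_clone p a A) (insert_after p a ax) \<longleftrightarrow> is_interval A ax"
proof -
  obtain u v where ax: "ax = u @ p # v" using split_axis_at[OF assms(2-)] by blast
  have "holes (word (add_clone p a A) (insert_after p a ax)) = holes (word A ax)"
    using word_insert_after[of A C u p v a] assms by (simp add: ax holes_duplicate)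
  then show ?thesis
    using is_interval_iff_holes is_axis_insert_after[OF assms(2-)] assms(2) unfolding is_axis_def
    by metis
qed

lemma is_axis_restrict_axis_insert:
  assumes "is_axis (insert a C) ax" "a \<notin> C"
  shows "is_axis C (restrict_axis a ax)"
  using is_axis_restrict_axis[OF assms(1), of a] assms(2) by simp

lemma word_adjacent_clones:
  assumes ax: "is_axis (insert a C) ax" "is_interval {a, p} ax" and A: "A \<subseteq> C"
    and C: "p \<in> C" "a \<notin> C"
  shows "word (add_clone p a A) ax = word (add_clone p a A) (insert_after p a (restrict_axis a ax))"
proof -
  have "distinct ax" "a \<in> set ax" "p \<in> set ax" "a \<noteq> p" using ax C by (auto simp: is_axis_def)
  then obtain u v where "ax = u @ a # p # v \<or> ax = u @ p # a # v"
    using adjacent_if_is_interval_pair ax(2) by metis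
  moreover from this have "a \<notin> set u" "p \<notin> set u" "a \<notin> set v"
    using ax(1) by (auto simp: is_axis_def)
  moreover have "a \<in> add_clone p a A \<longleftrightarrow> p \<in> add_clone p a A" using A C by (auto simp: add_clone_def)
  ultimately show ?thesis using C by (auto simp: insert_after_append)
qed

lemma restrict_axis_con_pair:
  assumes C: "p \<in> C" "a \<notin> C"
  shows "restrict_axis a ` con (insert a C) [{a, p}] = axes C"
proof (intro equalityI subsetI)
  fix ax assume "ax \<in> axes C"
  then have ax: "is_axis C ax" by simp
  then obtain u v where uv: "ax = u @ p # v" "p \<notin> set u" "a \<notin> set (u @ p # v)"
    using split_axis_at[OF ax C] by blast
  have "is_interval {a, p} (insert_after p a ax)"
    using is_interval_adjacent_pair[of u p a v] is_axis_insert_after[OF ax C]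
    by (simp add: uv insert_after_append insert_commute is_axis_def)
  then have "insert_after p a ax \<in> con (insert a C) [{a, p}]"
    using is_axis_insert_after[OF ax C] by (simp add: con_def)
  then show "ax \<in> restrict_axis a ` con (insert a C) [{a, p}]"
    using restrict_axis_insert_after[of a ax p] uv(1,3) by (metis imageI)
qed (use C in \<open>auto simp: con_def intro: is_axis_restrict_axis_insert\<close>)

lemma remove_cand_append [simp]: "remove_cand a (P @ Q) = remove_cand a P @ remove_cand a Q"
  by (simp add: remove_cand_def)

lemma remove_cand_add_clone:
  assumes "is_profile C P" "a \<notin> C"
  shows "remove_cand a (map (add_clone p a) P) = P"
  using assms(1) by (induction P) (use assms(2) in \<open>auto simp: remove_cand_def add_clone_def\<close>)

lemma (in linear_scoring_rule) rule_append_if_all_consistent: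
  assumes "finite C" "is_profile C P" "is_profile C Q" "axes C \<subseteq> con C Q"
  shows "f C (Q @ P) = f C P"
proof -
  obtain c where c: "normal_cost f C c" using ex_normal_cost[OF assms(1)] .
  have "total_cost c Q ax = 0" if "ax \<in> axes C" for ax
    using total_cost_eq_0_iff[OF c assms(3), of ax] that assms(4) by auto
  then have "cheapest c (axes C) (Q @ P) = cheapest c (axes C) P" by (intro cheapest_cong) simp
  then show ?thesis using rule_eq_cheapest[OF c] assms(2,3) by simp
qed

locale clone_resistant_scoring_rule = neutral_linear_scoring_rule f for f :: "'a axis_rule" +
  assumes infinite_UNIV: "infinite (UNIV :: 'a set)"
    and cloning: "resistant_to_cloning f"
begin

lemma rule_remove_clone:
  assumes "finite C" "is_profile C P" "a \<in> C" "a' \<in> C" "a \<noteq> a'" "clones P a a'"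
  shows "f (C - {a}) (remove_cand a P) = restrict_axis a ` f C P"
proof -
  have "(\<forall>ax \<in> f C P. restrict_axis a ax \<in> f (C - {a}) (remove_cand a P)) \<and>
      (\<forall>bx \<in> f (C - {a}) (remove_cand a P). \<exists>ax \<in> f C P. restrict_axis a ax = bx)"
    using cloning assms unfolding resistant_to_cloning_def by blast
  then show ?thesis by (intro equalityI subsetI) (metis imageI, blast)
qed

text \<open>Copies of the ballot \<open>{a, p}\<close> force the clones \<open>a\<close> and \<open>p\<close> to be adjacent, and become costless
  once \<open>a\<close> is removed.\<close>

lemma rule_eq_restrict_clone_adjacent:
  assumes fin: "finite C" and C: "p \<in> C" "a \<notin> C" and P: "is_profile C P" and Q: "set Q = {{a, p}}"
  shows "f C P = restrict_axis a ` f (insert a C) (Q @ map (add_clone p a) P)"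
proof -
  let ?C = "insert a C" and ?P = "map (add_clone p a) P"
  have "is_profile ?C ?P" using P by (auto simp: is_profile_def add_clone_def)
  then have QP: "is_profile ?C (Q @ ?P)" using Q C(1) by (simp add: is_profile_def)
  have singleton: "set (remove_cand a Q) \<subseteq> {{p}}" using Q C by (auto simp: remove_cand_def)
  have "f C P = f C (remove_cand a Q @ P)"
  proof (rule rule_append_if_all_consistent[OF fin P, symmetric])
    show "is_profile C (remove_cand a Q)" using singleton C(1) by (auto simp: is_profile_def)
    show "axes C \<subseteq> con C (remove_cand a Q)"
      using singleton is_interval_singleton by (fastforce simp: con_def is_axis_def)
  qed
  also have "\<dots> = f (?C - {a}) (remove_cand a (Q @ ?P))"
    using remove_cand_add_clone[OF P C(2)] C(2) by simp
  also have "\<dots> = restrict_axis a ` f ?C (Q @ ?P)"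
  proof (rule rule_remove_clone)
    show "clones (Q @ ?P) a p"
      using Q P C by (auto simp: clones_def add_clone_def is_profile_def)
  qed (use fin C QP in auto)
  finally show ?thesis .
qed

lemma normal_cost_add_clone:
  assumes fin: "finite C" and C: "p \<in> C" "a \<notin> C"
    and g: "normal_cost f (insert a C) (word_cost g)"
  shows "normal_cost f C (cloned_cost p a (word_cost g))" (is "normal_cost f C ?c")
proof (rule normal_costI)
  fix P assume P: "is_profile C P"
  let ?C = "insert a C" and ?P = "map (add_clone p a) P" and ?S = "con (insert a C) [{a, p}]"
  have prof: "is_profile ?C ?P" "is_profile ?C [{a, p}]"
    using P C(1) by (auto simp: is_profile_def add_clone_def)
  have "?S \<noteq> {}" using fin C(1) by (intro rule_single_ballot(2)) auto
  then obtain Q where Q: "set Q = {{a, p}}" "f ?C (Q @ ?P) = cheapest (word_cost g) ?S ?P"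
    using ex_forcing_profile[OF _ prof(2) _ prof(1)] fin g
    by (metis finite_insert list.set(1) list.simps(15))
  have "total_cost (word_cost g) ?P ax = total_cost ?c P (restrict_axis a ax)" if "ax \<in> ?S" for ax
    using P that by (induction P) (simp_all add: word_adjacent_clones[OF _ _ _ C] con_def)
  then have "restrict_axis a ` cheapest (word_cost g) ?S ?P = cheapest ?c (restrict_axis a ` ?S) P"
    by (rule cheapest_image[symmetric])
  then show "f C P = cheapest ?c (axes C) P"
    using rule_eq_restrict_clone_adjacent[OF fin C P Q(1)] Q(2) restrict_axis_con_pair[OF C] by simp
next
  fix A ax assume A: "A \<noteq> {}" "A \<subseteq> C" and ax: "is_axis C ax"
  moreover from this have "add_clone p a A \<noteq> {}" "add_clone p a A \<subseteq> insert a C"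
    by (auto simp: add_clone_def)
  ultimately show "0 \<le> ?c A ax \<and> (?c A ax = 0 \<longleftrightarrow> is_interval A ax)"
    using normal_cost_nonneg[OF g] normal_cost_eq_0_iff[OF g] is_axis_insert_after[OF ax C]
      is_interval_insert_after[OF A(2) ax C] by simp
qed

end

lemma ex_axis_ballot_word_at:
  assumes "finite C" "p \<in> C" "length (u @ b # v) = card C"
  obtains A xs ys where "A \<subseteq> C" "is_axis C (xs @ p # ys)"
    "word A xs = u" "(p \<in> A) = b" "word A ys = v"
proof -
  obtain l where l: "is_axis (C - {p}) l" using ex_axis[of "C - {p}"] assms(1) by auto
  define xs ys where "xs = take (length u) l" and "ys = drop (length u) l"
  have "length l = card C - 1" using length_axis[OF l] assms(2) by simp
  then have xs: "length xs = length u" using assms(3) by (simp add: xs_def)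
  have "distinct (xs @ ys)" "set (xs @ ys) = C - {p}"
    using l by (simp_all add: xs_def ys_def is_axis_def)
  then have ax: "is_axis C (xs @ p # ys)" using assms(2) by (auto simp: is_axis_def)
  then obtain A where "A \<subseteq> C" "word A (xs @ p # ys) = u @ b # v"
    using ex_ballot_word[of "xs @ p # ys" "u @ b # v"] length_axis[OF ax] assms(3)
    by (metis is_axis_def)
  then show ?thesis using that ax xs by auto
qed

definition single_gap :: "nat \<Rightarrow> bool list" where
  "single_gap m = True # replicate (m - 2) False @ [True]"

lemma length_single_gap: "2 \<le> m \<Longrightarrow> length (single_gap m) = m"
  by (simp add: single_gap_def)

lemma holes_single_gap:
  assumes "3 \<le> m"
  shows "holes (single_gap m) = 1"
proof -
  have "holes (replicate k False @ [True]) = 0" for k by (induction k) auto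
  moreover obtain k where "m - 2 = Suc k" using assms by (cases "m - 2") auto
  ultimately show ?thesis by (simp add: single_gap_def)
qed

context clone_resistant_scoring_rule
begin

lemma word_cost_duplicate_proportional:
  assumes m: "3 \<le> m"
    and g: "\<And>C. finite C \<Longrightarrow> card C = m \<Longrightarrow> normal_cost f C (word_cost g)"
    and g': "\<And>C. finite C \<Longrightarrow> card C = Suc m \<Longrightarrow> normal_cost f C (word_cost g')"
  obtains \<alpha> where "\<And>u b v. length (u @ b # v) = m \<Longrightarrow> True \<in> set (u @ b # v) \<Longrightarrow>
    g' (u @ b # b # v) = \<alpha> * g (u @ b # v)"
proof -
  obtain C' :: "'a set" where C': "finite C'" "card C' = Suc m"
    using infinite_arbitrarily_large[OF infinite_UNIV] by blast
  then obtain a C where C: "C' = insert a C" "a \<notin> C" "card C = m" "finite C"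
    by (metis card_Suc_eq finite_insert)
  then obtain p where p: "p \<in> C" using m by fastforce
  have "normal_cost f C (cloned_cost p a (word_cost g'))"
    using normal_cost_add_clone[OF C(4) p C(2)] g'[OF C'] C(1) by simp
  then obtain \<alpha> where "0 < \<alpha>" and \<alpha>: "\<And>A ax. A \<noteq> {} \<Longrightarrow> A \<subseteq> C \<Longrightarrow> is_axis C ax \<Longrightarrow>
      cloned_cost p a (word_cost g') A ax = \<alpha> * word_cost g A ax"
    using normal_cost_unique[OF C(4) _ g[OF C(4,3)]] C(3) m by metis
  have "g' (u @ b # b # v) = \<alpha> * g (u @ b # v)"
    if len: "length (u @ b # v) = m" and True: "True \<in> set (u @ b # v)" for u b v
  proof -
    obtain A xs ys where A: "A \<subseteq> C" and ax: "is_axis C (xs @ p # ys)"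
      and words: "word A xs = u" "(p \<in> A) = b" "word A ys = v"
      using ex_axis_ballot_word_at[OF C(4) p len[folded C(3)]] .
    then have "A \<noteq> {}" using True True_in_set_word[of A "xs @ p # ys"] by auto
    then show ?thesis
      using \<alpha>[OF _ A ax] word_insert_after[OF A ax C(2)] by (simp add: words)
  qed
  then show ?thesis using that by blast
qed

lemma ex_normalised_word_cost:
  assumes "3 \<le> m"
  shows "\<exists>g. g (single_gap m) = 1 \<and> (\<forall>C. finite C \<longrightarrow> card C = m \<longrightarrow> normal_cost f C (word_cost g))"
proof -
  obtain C0 :: "'a set" where C0: "finite C0" "card C0 = m"
    using infinite_arbitrarily_large[OF infinite_UNIV] by blast
  obtain g where g: "\<And>C. finite C \<Longrightarrow> card C = m \<Longrightarrow> normal_cost f C (word_cost g)"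
    using ex_normal_word_cost[of C0] C0 assms by blast
  have "0 < g (single_gap m)"
    using normal_word_cost_pos[OF C0(1) g[OF C0], of "single_gap m"] C0(2) assms
    by (simp add: length_single_gap holes_single_gap)
  then show ?thesis
    using normal_cost_divide[OF g] unfolding word_cost_def
    by (intro exI[of _ "\<lambda>w. g w / g (single_gap m)"]) simp
qed

text \<open>Both normalisations refer to a word whose gap can be lengthened by a duplication, which fixes
  the factor.\<close>

lemma normalised_word_cost_duplicate:
  assumes m: "3 \<le> m"
    and g: "\<And>C. finite C \<Longrightarrow> card C = m \<Longrightarrow> normal_cost f C (word_cost g)" "g (single_gap m) = 1"
    and g': "\<And>C. finite C \<Longrightarrow> card C = Suc m \<Longrightarrow> normal_cost f C (word_cost g')"
      "g' (single_gap (Suc m)) = 1"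
    and w: "length (u @ b # v) = m" "True \<in> set (u @ b # v)"
  shows "g' (u @ b # b # v) = g (u @ b # v)"
proof -
  obtain \<alpha> where \<alpha>: "\<And>u b v. length (u @ b # v) = m \<Longrightarrow> True \<in> set (u @ b # v) \<Longrightarrow>
      g' (u @ b # b # v) = \<alpha> * g (u @ b # v)"
    using word_cost_duplicate_proportional[OF m g(1) g'(1)] by blast
  obtain k where k: "m = Suc (Suc (Suc k))"
    using m by (metis Suc_le_D numeral_3_eq_3 Suc_le_mono)
  let ?v = "replicate k False @ [True]"
  have "single_gap m = [True] @ False # ?v" "single_gap (Suc m) = [True] @ False # False # ?v"
    by (simp_all add: single_gap_def k)
  then have "\<alpha> = 1" using \<alpha>[of "[True]" False ?v] g(2) g'(2) by (simp add: k)
  then show ?thesis using \<alpha>[OF w] by simp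
qed

lemma ex_duplication_invariant_word_cost:
  obtains G :: "bool list \<Rightarrow> real" where
    "\<And>C. finite C \<Longrightarrow> 3 \<le> card C \<Longrightarrow> normal_cost f C (word_cost G)"
    "\<And>u b v. 3 \<le> length (u @ b # v) \<Longrightarrow> True \<in> set (u @ b # v) \<Longrightarrow>
      G (u @ b # b # v) = G (u @ b # v)"
proof -
  obtain g where g: "\<And>m. 3 \<le> m \<Longrightarrow> g m (single_gap m) = 1"
    "\<And>m C. 3 \<le> m \<Longrightarrow> finite C \<Longrightarrow> card C = m \<Longrightarrow> normal_cost f C (word_cost (g m))"
    using ex_normalised_word_cost by metis
  show ?thesis
  proof (rule that[of "\<lambda>w. g (length w) w"])
    fix C :: "'a set" assume C: "finite C" "3 \<le> card C"
    show "normal_cost f C (word_cost (\<lambda>w. g (length w) w))"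
      by (rule normal_cost_cong[OF g(2)[OF C(2,1) refl]]) (simp add: length_axis)
  next
    fix u b v assume w: "3 \<le> length (u @ b # v)" "True \<in> set (u @ b # v)"
    let ?m = "length (u @ b # v)"
    show "g (length (u @ b # b # v)) (u @ b # b # v) = g ?m (u @ b # v)"
      using normalised_word_cost_duplicate[OF w(1) g(2)[OF w(1)] g(1)[OF w(1)] g(2)[of "Suc ?m"]
          g(1)[of "Suc ?m"] refl w(2)] w(1) by simp
  qed
qed

end

section \<open>Clearance and the two hole functions\<close>

primrec star :: "nat \<Rightarrow> bool list" where
  "star 0 = [True]"
| "star (Suc n) = True # False # star n"

lemma star_simps [simp]:
  "length (star n) = Suc (2 * n)" "True \<in> set (star n)" "star n \<noteq> []" "hd (star n)" "last (star n)"
  "holes (star n) = n"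
  by (induction n) auto

lemma holes_star_insert:
  "u @ v = star n \<Longrightarrow> holes (u @ True # v) = n"
proof (induction n arbitrary: u)
  case 0
  then show ?case by (cases u) auto
next
  case (Suc n)
  consider "u = []" | "u = [True]" | t where "u = True # False # t" "t @ v = star n"
    using Suc.prems by (cases u rule: remdups_adj.cases) auto
  then show ?case
  proof cases
    case 3
    then show ?thesis using Suc.IH[of t] by (cases t) auto
  qed (use Suc.prems in auto)
qed

lemma rev_star [simp]: "rev (star n) = star n"
proof (induction n)
  case (Suc n)
  have "star n @ [False, True] = True # False # star n" by (induction n) auto
  then show ?case using Suc by simp
qed simp

lemma holes_append_star: "True \<in> set w \<Longrightarrow> holes (w @ False # star k) = holes w + Suc k"
proof (induction w rule: holes.induct)
  case (1 x y w)
  have "holes (w @ False # star k) = k" "holes w = 0" if "True \<notin> set w" for w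
    using that by (induction w) auto
  with 1 show ?case by auto
qed auto

lemma holes_single_member_append_star:
  assumes "distinct xs" "A \<inter> set xs = {y}" "word A ys = False # star k"
  shows "holes (word A (xs @ ys)) = Suc k"
proof -
  have "word A xs = word {y} xs" using assms(2) by (auto simp: word_def)
  moreover have "holes (word {y} xs) = 0"
    using is_interval_iff_holes[OF assms(1)] is_interval_singleton[OF assms(1)] by blast
  moreover have "True \<in> set (word {y} xs)" using assms(2) by (auto simp: True_in_set_word)
  ultimately show ?thesis using holes_append_star[of "word {y} xs" k] assms(3) by simp
qed

lemma distinct_adj_Cons_True_cases:
  assumes "distinct_adj (True # w)"
  shows "\<exists>n. True # w = star n \<or> True # w = star n @ [False]"
  using assms
proof (induction w rule: induct_list012)
  case 1
  then show ?case by (intro exI[of _ 0]) auto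
next
  case (2 x)
  then show ?case by (intro exI[of _ 0]) auto
next
  case (3 x y t)
  then have "x = False" "y = True" "distinct_adj (True # t)" by (auto simp: distinct_adj_Cons)
  moreover from this obtain n where "True # t = star n \<or> True # t = star n @ [False]"
    using 3 by blast
  ultimately show ?case by (intro exI[of _ "Suc n"]) auto
qed

lemma distinct_adj_holes_cases:
  assumes "distinct_adj w" "holes w = n" "0 < n"
  shows "w \<in> {star n, star n @ [False], False # star n, False # star n @ [False]}"
proof -
  have star: "True # t \<in> {star n, star n @ [False]}"
    if t: "distinct_adj (True # t)" "holes (True # t) = n" for t
    using distinct_adj_Cons_True_cases[OF t(1)] t(2)
    by (metis holes_snoc_False star_simps(6) insertCI)
  consider t where "w = True # t" | t where "w = False # True # t"
    using assms by (cases w rule: remdups_adj.cases) auto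
  then show ?thesis by cases (use star assms in auto)
qed

lemma con_Cons:
  assumes "ax \<in> con C L" "x \<notin> C" "is_profile C L"
  shows "x # ax \<in> con (insert x C) L"
proof -
  have "x \<notin> set ax" using assms by (auto simp: con_def is_axis_def)
  moreover have "x \<notin> A" if "A \<in> set L" for A using assms that by (auto simp: is_profile_def)
  ultimately show ?thesis using assms(1) by (auto simp: con_def is_axis_def is_interval_Cons)
qed

lemma con_restrict_axis:
  "ax \<in> con C L \<Longrightarrow> restrict_axis x ax \<in> con (C - {x}) (remove_cand x L)"
  using is_interval_restrict_axis is_axis_restrict_axis by (fastforce simp: con_def remove_cand_def)

lemma remove_cand_notin:
  assumes "is_profile C P" "x \<notin> C"
  shows "remove_cand x P = P"
  using assms(1) by (induction P) (use assms(2) in \<open>auto simp: remove_cand_def\<close>)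

lemma con_restrict_axis_notin:
  assumes "ax \<in> con (insert x C) L" "x \<notin> C" "is_profile C L"
  shows "restrict_axis x ax \<in> con C L"
  using con_restrict_axis[OF assms(1), of x] remove_cand_notin[OF assms(3,2)] assms(2) by simp

lemma is_profile_remove_cand: "is_profile C P \<Longrightarrow> is_profile (C - {x}) (remove_cand x P)"
  by (auto simp: is_profile_def remove_cand_def)

lemma is_profile_mono: "is_profile C P \<Longrightarrow> C \<subseteq> D \<Longrightarrow> is_profile D P"
  by (auto simp: is_profile_def)

lemma holes_if_restriction_rigid:
  assumes Y: "is_axis D Y" "y \<notin> D" and r: "r \<in> con (insert y D) (rigid Y)"
    and A: "y \<in> A" "word A Y = star n"
  shows "holes (word A r) = n"
proof -
  have "is_profile D (rigid Y)" using Y(1) by (simp add: is_profile_block_cuts is_axis_def)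
  then have "restrict_axis y r \<in> {Y, rev Y}"
    using con_restrict_axis_notin[OF r Y(2)] con_rigid[OF Y(1)] by simp
  moreover have "distinct r" "y \<in> set r" using r by (auto simp: con_def is_axis_def)
  then obtain u v where uv: "r = u @ y # v" "y \<notin> set u" "y \<notin> set v"
    by (metis split_list distinct_append distinct.simps(2) not_distinct_conv_prefix)
  ultimately have "u @ v \<in> {Y, rev Y}" by simp
  then have "word A (u @ v) = star n" using A(2) by (auto simp: word_rev simp del: word_simps)
  then show ?thesis using holes_star_insert[of "word A u" "word A v" n] A(1) uv(1) by simp
qed

lemma clears_if_at_end:
  assumes "x \<notin> set r"
  shows "clears P {x} (x # r)" "clears P {x} (r @ [x])"
  using assms by (auto simp: clears_def dest: in_set_if_before)

lemma ex_both_ends_in_rule: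
  assumes "inclusion_clearance f" "is_axis_rule f" and D: "finite D" "x \<notin> D"
    and P: "is_profile D P" "\<Union> (set P) = D"
  obtains r where "is_axis D r" "x # r \<in> f (insert x D) P" "r @ [x] \<in> f (insert x D) P"
proof -
  have P': "is_profile (insert x D) P" using is_profile_mono[OF P(1)] by blast
  have X: "insert x D - \<Union> (set P) = {x}" using D(2) P(2) by auto
  obtain ax where ax: "ax \<in> f (insert x D) P"
    and cleared: "\<And>bx. is_axis (insert x D) bx \<Longrightarrow> clears P {x} bx \<Longrightarrow>
      filter (\<lambda>y. y \<notin> {x}) bx = filter (\<lambda>y. y \<notin> {x}) ax \<Longrightarrow> bx \<in> f (insert x D) P"
    using assms(1)[unfolded inclusion_clearance_def Let_def, rule_format, OF _ P'] D(1)
    unfolding X by blast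
  define r where "r = restrict_axis x ax"
  have "is_axis (insert x D) ax"
    using assms(2) D(1) P' ax unfolding is_axis_rule_def axes_def by blast
  then have r: "is_axis D r" using is_axis_restrict_axis_insert[of x D ax] D(2) by (simp add: r_def)
  then have "x \<notin> set r" "is_axis (insert x D) (x # r)" "is_axis (insert x D) (r @ [x])"
    using D(2) by (auto simp: is_axis_def)
  moreover from this have "filter (\<lambda>y. y \<noteq> x) r = r" by (auto simp: filter_id_conv)
  ultimately show ?thesis
    using that[OF r] cleared[of "x # r"] cleared[of "r @ [x]"] clears_if_at_end[of x r P]
    by (simp add: r_def restrict_axis_def)
qed

lemma (in linear_scoring_rule) induced_on_hole_cost_if_card_less:
  assumes fin: "finite C" and card: "card C < 3"
  shows "induced_on f C (hole_cost hs h)"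
  unfolding induced_on_def argmin_axes_eq_cheapest
proof (intro allI impI)
  fix P assume P: "is_profile C P"
  have interval: "is_interval A ax" if ax: "is_axis C ax" for A ax
  proof -
    have "length ax < 3" using length_axis[OF ax] card by simp
    then consider "ax = []" | x where "ax = [x]" | x y where "ax = [x, y]"
      by (cases ax rule: remdups_adj.cases) (auto simp: less_Suc_eq)
    then show ?thesis using ax by cases (auto simp: is_interval_def is_axis_def)
  qed
  then have con: "con C P = axes C" by (auto simp: con_def)
  moreover have "total_cost (hole_cost hs h) P ax = 0" if "ax \<in> axes C" for ax
    using interval that by (induction P) (auto simp: hole_cost_def)
  moreover have "f C P = con C P"
    using linearity fin P con ex_axis[OF fin]
    by (auto simp: consistent_with_linearity_def linear_profile_def axes_def)
  ultimately show "f C P = cheapest (hole_cost hs h) (axes C) P"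
    by (auto simp: cheapest_def)
qed

locale clearing_word_cost = clone_resistant_scoring_rule f for f :: "'a axis_rule" +
  fixes G :: "bool list \<Rightarrow> real"
  assumes clearance: "inclusion_clearance f"
    and G_normal: "\<And>C. finite C \<Longrightarrow> 3 \<le> card C \<Longrightarrow> normal_cost f C (word_cost G)"
    and G_duplicate: "\<And>u b v. 3 \<le> length (u @ b # v) \<Longrightarrow> True \<in> set (u @ b # v) \<Longrightarrow>
      G (u @ b # b # v) = G (u @ b # v)"
begin

lemma ex_fresh_ballot_word:
  obtains ax :: "'a list" and A where "distinct ax" "A \<subseteq> set ax" "word A ax = w"
proof -
  obtain C :: "'a set" where C: "finite C" "card C = length w"
    using infinite_arbitrarily_large[OF infinite_UNIV] by blast
  then obtain ax where ax: "is_axis C ax" using ex_axis by blast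
  then show ?thesis
    using ex_ballot_word[of ax w] that length_axis[OF ax] C(2) by (metis is_axis_def)
qed

lemma G_pos:
  assumes "0 < holes w" "3 \<le> length w"
  shows "0 < G w"
proof -
  obtain C :: "'a set" where C: "finite C" "card C = length w"
    using infinite_arbitrarily_large[OF infinite_UNIV] by blast
  then have "3 \<le> card C" using assms(2) by simp
  then show ?thesis
    using normal_word_cost_pos[OF C(1) G_normal[OF C(1)] C(2)[symmetric] assms(1)] by blast
qed

lemma G_rev:
  assumes "3 \<le> length w" "True \<in> set w"
  shows "G (rev w) = G w"
proof -
  obtain ax :: "'a list" and A where A: "distinct ax" "A \<subseteq> set ax" "word A ax = w"
    using ex_fresh_ballot_word .
  then have axis: "is_axis (set ax) ax" "3 \<le> card (set ax)" and "A \<noteq> {}"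
    using assms True_in_set_word[of A ax] by (auto simp: is_axis_def distinct_card)
  then show ?thesis
    using normal_cost_rev[OF _ G_normal[OF _ axis(2)] _ A(2) axis(1)] A(3) by (simp add: word_rev)
qed

lemma G_remdups_adj:
  "3 \<le> length (u @ remdups_adj w) \<Longrightarrow> True \<in> set (u @ w) \<Longrightarrow> G (u @ w) = G (u @ remdups_adj w)"
proof (induction w arbitrary: u rule: remdups_adj.induct)
  case (3 x y xs)
  show ?case
  proof (cases "x = y")
    case True
    have "length (remdups_adj (x # xs)) \<le> length (x # xs)" by (rule remdups_adj_length)
    then have "G (u @ x # x # xs) = G (u @ x # xs)"
      using 3 True by (intro G_duplicate) auto
    then show ?thesis using 3 True by simp
  next
    case False
    then show ?thesis using 3(2)[OF False, of "u @ [x]"] 3(3,4) by simp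
  qed
qed auto

lemma ex_cleared_optimum:
  fixes D :: "'a set"
  assumes D: "finite D" "2 \<le> card D" "x \<notin> D" and L: "is_profile D L" "con D L \<noteq> {}"
    and A: "A \<noteq> {}" "A \<subseteq> D" and cover: "\<Union> (set L) \<union> A = D"
  defines "S \<equiv> cheapest (word_cost G) (con (insert x D) L) [A]"
  obtains r where "r \<in> con D L" "x # r \<in> S" "r @ [x] \<in> S"
proof -
  let ?C = "insert x D"
  have C: "finite ?C" "3 \<le> card ?C" using D by simp_all
  have L': "is_profile ?C L" "con ?C L \<noteq> {}"
    using is_profile_mono[OF L(1)] con_Cons[OF _ D(3) L(1)] L(2) by blast+
  have A': "is_profile ?C [A]" using A by auto
  obtain Q where Q: "set Q = set L" "f ?C (Q @ [A]) = S"
    using ex_forcing_profile[OF C(1) L' A'] G_normal[OF C] unfolding S_def by metis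
  have "is_profile D (Q @ [A])" "\<Union> (set (Q @ [A])) = D"
    using L(1) A is_profile_cong[OF Q(1)] cover Q(1) by auto
  then obtain r where "is_axis D r" "x # r \<in> S" "r @ [x] \<in> S"
    using ex_both_ends_in_rule[OF clearance axis_rule D(1,3)] Q(2) by metis
  moreover from this have "restrict_axis x (x # r) \<in> con D L"
    using con_restrict_axis_notin[OF _ D(3) L(1), of "x # r"] by (simp add: S_def cheapest_single)
  ultimately show ?thesis using that D(3) by (auto simp: is_axis_def)
qed

lemma G_shift:
  assumes "2 \<le> length w" "True \<in> set w"
  shows "G (False # w) = G (w @ [False])"
proof -
  obtain ax :: "'a list" and A where ax: "distinct ax" "A \<subseteq> set ax" "word A ax = False # w"
    using ex_fresh_ballot_word .
  then obtain x Y where Y: "ax = x # Y" "x \<notin> A" "word A Y = w" by (auto simp: word_eq_Cons_iff)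
  have fresh: "x \<notin> set Y" and axis: "is_axis (set Y) Y" and A: "A \<subseteq> set Y" "A \<noteq> {}"
    and len: "2 \<le> length Y"
    using ax Y assms True_in_set_word[of A Y] by (auto simp: is_axis_def)
  let ?S = "cheapest (word_cost G) (con (insert x (set Y)) (rigid Y)) [A]"
  obtain r where "r \<in> con (set Y) (rigid Y)" and opt: "x # r \<in> ?S" "r @ [x] \<in> ?S"
  proof (rule ex_cleared_optimum[OF _ _ fresh _ _ A(2,1)])
    show "\<Union> (set (rigid Y)) \<union> A = set Y" using Union_rigid[OF len] A(1) by auto
    show "2 \<le> card (set Y)" using axis len by (simp add: is_axis_def distinct_card)
    show "is_profile (set Y) (rigid Y)" by (simp add: is_profile_block_cuts)
  qed (use con_rigid[OF axis] in auto)
  then have "r = Y \<or> r = rev Y" using con_rigid[OF axis] by simp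
  moreover have "word_cost G A (x # r) = word_cost G A (r @ [x])"
    using opt unfolding cheapest_single by (meson order.antisym)
  ultimately have "G (False # w) = G (w @ [False]) \<or> G (rev (w @ [False])) = G (rev (False # w))"
    using Y(2,3) by (auto simp: word_rev)
  then show ?thesis using G_rev[of "w @ [False]"] G_rev[of "False # w"] assms by auto
qed

lemma G_eq_star:
  assumes "holes w = n" "0 < n"
  shows "G w = (if hd w \<and> last w then G (star n) else G (False # star n))"
proof -
  define r where "r = remdups_adj w"
  have "w \<noteq> []" using assms by auto
  then have ends: "hd r = hd w" "last r = last w" by (simp_all add: r_def)
  have r: "r \<in> {star n, star n @ [False], False # star n, False # star n @ [False]}"
    using distinct_adj_holes_cases[of r n] holes_remdups_adj[of "[]" w] assms by (simp add: r_def)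
  then have "3 \<le> length r" "True \<in> set r" using assms(2) by auto
  then have "G w = G r" using G_remdups_adj[of "[]" w] by (simp add: r_def)
  moreover have "G (star n @ [False]) = G (False # star n)"
    using G_shift[of "star n"] assms by simp
  moreover have "G (False # star n @ [False]) = G (False # star n)"
    using G_shift[of "False # star n"] G_duplicate[of "[]" False "star n"] assms by simp
  ultimately show ?thesis using r unfolding ends[symmetric] by auto
qed

lemma G_star_le_Suc:
  assumes "0 < n"
  shows "G (False # star n) \<le> G (star (Suc n))"
proof -
  obtain ax :: "'a list" and A where ax: "distinct ax" "A \<subseteq> set ax" "word A ax = star (Suc n)"
    using ex_fresh_ballot_word .
  then obtain x y Y where Y: "ax = y # x # Y" "y \<in> A" "x \<notin> A" "word A Y = star n"
    by (auto simp: word_eq_Cons_iff)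
  define D where "D = insert y (set Y)"
  have axis: "is_axis (set Y) Y" and fresh: "y \<notin> set Y" "x \<notin> D"
    and A: "A \<noteq> {}" "A \<subseteq> D"
    using ax(1,2) Y(1-3) by (auto simp: D_def is_axis_def)
  have prof: "is_profile C (rigid Y)" if "set Y \<subseteq> C" for C
    using that by (simp add: is_profile_block_cuts)
  have len: "2 \<le> length Y" using arg_cong[OF Y(4), of length] assms by simp
  obtain r where r: "r \<in> con D (rigid Y)"
    and opt: "x # r \<in> cheapest (word_cost G) (con (insert x D) (rigid Y)) [A]"
  proof (rule ex_cleared_optimum[OF _ _ fresh(2) _ _ A])
    show "con D (rigid Y) \<noteq> {}"
      using con_Cons[OF _ fresh(1) prof, of Y] con_rigid[OF axis] by (auto simp: D_def)
    show "\<Union> (set (rigid Y)) \<union> A = D" using Union_rigid[OF len] A(2) Y(2) by (auto simp: D_def)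
    show "2 \<le> card D" using axis len fresh(1) by (simp add: D_def is_axis_def distinct_card)
  qed (use prof[of D] in \<open>auto simp: D_def\<close>)
  have "x # Y \<in> con (insert x (set Y)) (rigid Y)"
    using con_Cons[of Y "set Y" "rigid Y" x] prof con_rigid[OF axis] fresh(2) by (simp add: D_def)
  then have "y # x # Y \<in> con (insert x D) (rigid Y)"
    using con_Cons[of "x # Y" "insert x (set Y)" "rigid Y" y] prof[of "insert x (set Y)"]
      fresh Y(2,3) by (auto simp: D_def insert_commute)
  then have "word_cost G A (x # r) \<le> word_cost G A (y # x # Y)"
    using opt unfolding cheapest_single by blast
  moreover have "holes (word A r) = n"
    using holes_if_restriction_rigid[OF axis fresh(1) _ Y(2,4)] r by (simp add: D_def)
  ultimately show ?thesis using G_eq_star[of "False # word A r" n] assms Y(2-4) by simp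
qed

text \<open>Resistance to cloning transfers the optimality of \<open>ax\<close> to its restriction.\<close>

lemma G_restrict_axis_le:
  fixes C :: "'a set"
  assumes C: "finite C" "4 \<le> card C" "a \<in> C" "a' \<in> C" "a \<noteq> a'"
    and L: "is_profile C L" "clones L a a'" and A: "A \<noteq> {}" "A \<subseteq> C" "a \<notin> A" "a' \<notin> A"
    and ax: "ax \<in> cheapest (word_cost G) (con C L) [A]" and bx: "bx \<in> con C L"
  shows "G (word A (restrict_axis a ax)) \<le> G (word A (restrict_axis a bx))"
proof -
  let ?C = "C - {a}"
  have normal: "normal_cost f C (word_cost G)" "normal_cost f ?C (word_cost G)"
    using G_normal C by simp_all
  have "is_profile C [A]" "con C L \<noteq> {}" using A bx by auto
  then obtain Q where Q: "set Q = set L" "f C (Q @ [A]) = cheapest (word_cost G) (con C L) [A]"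
    using ex_forcing_profile[OF C(1) L(1)] normal(1) by metis
  have Q_prof: "is_profile C Q" using L(1) is_profile_cong[OF Q(1)] by blast
  have QA: "is_profile C (Q @ [A])" using Q_prof A by simp
  have Q_free: "total_cost (word_cost G) (remove_cand a Q) (restrict_axis a cx) = 0"
    and axis: "is_axis ?C (restrict_axis a cx)" if "cx \<in> con C L" for cx
  proof -
    have "restrict_axis a cx \<in> con ?C (remove_cand a Q)"
      using con_restrict_axis[of cx C Q a] that con_cong[OF Q(1)] by blast
    moreover from this show "is_axis ?C (restrict_axis a cx)" by (simp add: con_def)
    ultimately show "total_cost (word_cost G) (remove_cand a Q) (restrict_axis a cx) = 0"
      using total_cost_eq_0_iff[OF normal(2) is_profile_remove_cand[OF Q_prof]] by blast
  qed
  have "clones (Q @ [A]) a a'" using L(2) A Q(1) by (auto simp: clones_def)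
  then have "restrict_axis a ax \<in> f ?C (remove_cand a (Q @ [A]))"
    using rule_remove_clone[OF C(1) QA C(3-5)] ax Q(2) by blast
  moreover have "remove_cand a (Q @ [A]) = remove_cand a Q @ [A]"
    using remove_cand_notin[of "C - {a}" "[A]" a] A by auto
  moreover have "is_profile ?C (remove_cand a Q @ [A])"
    using is_profile_remove_cand[OF Q_prof] A by auto
  ultimately have "restrict_axis a ax \<in> cheapest (word_cost G) (axes ?C) (remove_cand a Q @ [A])"
    using rule_eq_cheapest[OF normal(2)] by simp
  then have "total_cost (word_cost G) (remove_cand a Q @ [A]) (restrict_axis a ax) \<le>
      total_cost (word_cost G) (remove_cand a Q @ [A]) (restrict_axis a bx)"
    using axis[OF bx] by (simp add: cheapest_def)
  moreover have "ax \<in> con C L" using ax by (simp add: cheapest_def)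
  ultimately show ?thesis using Q_free bx by simp
qed

lemma cheapest_if_member_not_first:
  assumes dist: "distinct (M @ Z)" and A: "A \<inter> set M = {y}" "word A Z = False # star k"
    and le: "G (False # star (Suc k)) \<le> G (star (Suc k))"
    and N: "distinct N" "set N = set M" "hd N \<noteq> y"
  shows "N @ Z \<in> cheapest (word_cost G) (con (set (M @ Z)) (block_cuts [] M Z)) [A]"
proof -
  have con: "con (set (M @ Z)) (block_cuts [] M Z) =
      {N @ Z | N. distinct N \<and> set N = set M} \<union> rev ` {N @ Z | N. distinct N \<and> set N = set M}"
    using con_block_cuts[of "[]" M Z] dist by (simp add: block_axes_def)
  have ends: "hd (word A (N @ Z)) \<longleftrightarrow> hd N \<in> A" "last (word A (N @ Z))"
    if "set N = set M" for N
    using that A by (cases N; auto simp: hd_append)+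
  have G: "G (word A (K @ Z)) = (if hd K \<in> A then G (star (Suc k)) else G (False # star (Suc k)))"
    if K: "distinct K" "set K = set M" for K
    using G_eq_star[OF holes_single_member_append_star[OF K(1) _ A(2), of y]] ends[OF K(2)]
      A(1) K(2) by simp
  have G_rev_K: "G (word A (rev (K @ Z))) = G (word A (K @ Z))" if "set K = set M" for K
  proof -
    have "3 \<le> length (word A (K @ Z))"
      using arg_cong[OF A(2), of length] A(1) that by (cases K) auto
    moreover have "True \<in> set (word A (K @ Z))" using A(2) by auto
    ultimately show ?thesis using G_rev by (simp only: word_rev)
  qed
  have "hd N \<notin> A" using N(2,3) A(1) hd_in_set[of N] by (cases "N = []") auto
  then have "G (word A (N @ Z)) \<le> G (word A ax)"
    if "ax \<in> con (set (M @ Z)) (block_cuts [] M Z)" for ax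
    using that G[OF N(1,2)] G G_rev_K le unfolding con by auto
  moreover have "N @ Z \<in> con (set (M @ Z)) (block_cuts [] M Z)" using N(1,2) unfolding con by blast
  ultimately show ?thesis unfolding cheapest_single by simp
qed

text \<open>If duplicating the leftmost hole and moving the copy to the left end were profitable, then the
  restricted axis would be selected although swapping its first two candidates improves it.\<close>

lemma G_star_le:
  assumes "0 < n"
  shows "G (star n) \<le> G (False # star n)"
proof (rule ccontr)
  assume "\<not> ?thesis"
  then have less: "G (False # star n) < G (star n)" by simp
  obtain k where n: "n = Suc k" using assms by (cases n) auto
  obtain ax :: "'a list" and A where ax: "distinct ax" "A \<subseteq> set ax"
    "word A ax = False # False # True # False # star k"
    using ex_fresh_ballot_word .
  then obtain a a' y Z where Z: "ax = [a, a', y] @ Z" "a \<notin> A" "a' \<notin> A" "y \<in> A"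
    "word A Z = False # star k"
    by (auto simp: word_eq_Cons_iff)
  let ?C = "set ([a, a', y] @ Z)" and ?L = "block_cuts [] [a, a', y] Z"
  have dist: "distinct ([a, a', y] @ Z)" using ax(1) Z(1) by simp
  have opt: "[a, y, a'] @ Z \<in> cheapest (word_cost G) (con ?C ?L) [A]"
    using cheapest_if_member_not_first[OF dist _ Z(5), of y "[a, y, a']"] less n dist Z(2-4) by auto
  have "G (word A (restrict_axis a ([a, y, a'] @ Z))) \<le>
      G (word A (restrict_axis a ([a, a', y] @ Z)))"
  proof (rule G_restrict_axis_le[OF _ _ _ _ _ _ _ _ _ Z(2,3) opt])
    show "4 \<le> card ?C" using distinct_card[OF dist] arg_cong[OF Z(5), of length] by simp
    show "clones ?L a a'"
      using block_subset_or_disjoint[of "[]" "[a, a', y]" Z] dist by (auto simp: clones_def)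
    show "[a, a', y] @ Z \<in> con ?C ?L"
      using con_block_cuts[of "[]" "[a, a', y]" Z ?C] dist by (auto simp: block_axes_def)
  qed (use dist ax(2) Z in \<open>auto intro: is_profile_block_cuts\<close>)
  then have "G (word A (y # a' # Z)) \<le> G (word A (a' # y # Z))" using dist by simp
  then show False
    using G_eq_star[of "word A (y # a' # Z)" n] G_eq_star[of "word A (a' # y # Z)" n]
      Z(2-5) n less by simp
qed

lemma hole_cost_eq_word_cost:
  fixes C :: "'a set"
  assumes C: "finite C" "3 \<le> card C" and A: "A \<noteq> {}" "A \<subseteq> C" and ax: "is_axis C ax"
  shows "hole_cost (\<lambda>n. G (star n)) (\<lambda>n. G (False # star n)) A ax = word_cost G A ax"
proof (cases "is_interval A ax")
  case True
  then show ?thesis using normal_cost_eq_0_iff[OF G_normal[OF C] A ax] by (simp add: hole_cost_def)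
next
  case False
  then have "0 < holes (word A ax)"
    using is_interval_iff_holes[of ax A] ax by (simp add: is_axis_def)
  moreover have "ax \<noteq> []" using A ax by (auto simp: is_axis_def)
  then have "hd (word A ax) \<longleftrightarrow> hd ax \<in> A" "last (word A ax) \<longleftrightarrow> last ax \<in> A"
    by (simp_all add: word_def hd_map last_map)
  ultimately show ?thesis
    using G_eq_star[OF refl, of "word A ax"] False by (simp add: hole_cost_def num_holes_word)
qed

lemma induced_on_hole_cost:
  assumes fin: "finite C"
  shows "induced_on f C (hole_cost (\<lambda>n. G (star n)) (\<lambda>n. G (False # star n)))"
proof (cases "3 \<le> card C")
  case True
  then show ?thesis
    using normal_cost_cong[OF G_normal[OF fin True] hole_cost_eq_word_cost[OF fin True]]
    by (simp add: normal_cost_def)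
next
  case False
  then show ?thesis using induced_on_hole_cost_if_card_less[OF fin] by simp
qed

end

theorem mainTheorem20:
  fixes f :: "'a axis_rule"
  assumes "infinite (UNIV :: 'a set)"
    and "is_axis_rule f"
    and "scoring_rule f"
    and "neutral f"
    and "consistent_with_linearity f"
    and "resistant_to_cloning f"
    and "inclusion_clearance f"
  shows "\<exists>hs h :: nat \<Rightarrow> real.
           (\<forall>n \<ge> 1. hs n > 0 \<and> h n > 0) \<and>
           (\<forall>C. finite C \<longrightarrow> induced_on f C (hole_cost hs h)) \<and>
           (\<forall>n \<ge> 1. hs n \<le> h n \<and> h n \<le> hs (n + 1))"
proof -
  interpret clone_resistant_scoring_rule f using assms by unfold_locales
  obtain G where G: "\<And>C :: 'a set. finite C \<Longrightarrow> 3 \<le> card C \<Longrightarrow> normal_cost f C (word_cost G)"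
    "\<And>u b v. 3 \<le> length (u @ b # v) \<Longrightarrow> True \<in> set (u @ b # v) \<Longrightarrow>
      G (u @ b # b # v) = G (u @ b # v)"
    using ex_duplication_invariant_word_cost by blast
  interpret clearing_word_cost f G using assms(7) G by unfold_locales
  let ?hs = "\<lambda>n. G (star n)" and ?h = "\<lambda>n. G (False # star n)"
  have "\<forall>n \<ge> 1. ?hs n > 0 \<and> ?h n > 0" using G_pos by simp
  moreover have "\<forall>C. finite C \<longrightarrow> induced_on f C (hole_cost ?hs ?h)"
    using induced_on_hole_cost by blast
  moreover have "\<forall>n \<ge> 1. ?hs n \<le> ?h n \<and> ?h n \<le> ?hs (n + 1)"
    using G_star_le G_star_le_Suc by simp
  ultimately show ?thesis by (intro exI[of _ ?hs] exI[of _ ?h] conjI)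
qed

end
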